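(* Let $\mu$ be a positive-definite measure on $\mathbb{R}^n$ of the form $\mu=\sum_{\lambda\in\Lambda}\mu(\lambda)\delta_\lambda$ with $\mu(\lambda)\neq 0$ for all $\lambda\in\Lambda$, where $\Lambda\subset\mathbb{R}^n$ is a uniformly discrete set. Assume that $\hat\mu$ is a slowly increasing measure which is purely atomic, $\hat\mu=\sum_{s\in S}\hat\mu(s)\delta_s$ with $S$ countable and $\hat\mu(s)\neq 0$ for all $s\in S$. Then, either (i) $S$ is also uniformly discrete; or (ii) the set of accumulation points of $S$ in $\mathbb{R}^n$ is relatively dense.
   Context: A "measure" on $\mathbb{R}^n$ means a complex, locally finite measure $\mu$ that is slowly increasing: there is $N$ with $|\mu|(\{|x|<R\})=O(R^N)$ as $R\to\infty$. Such a measure is a temperate distribution, and $\hat\mu$ denotes its distributional Fourier transform, $\langle\hat\mu,\varphi\rangle=\langle\mu,\hat\varphi\rangle$ for Schwartz $\varphi$, with $\hat\varphi(t)=\int\varphi(x)e^{-2\pi i\langle t,x\rangle}dx$. A measure is positive-definite if its Fourier transform is a positive distribution (nonnegative on nonnegative Schwartz functions). $\delta_x$ is the unit point mass at $x$. A set $A\subset\mathbb{R}^n$ is uniformly discrete if $\inf\{|x-y|:x,y\in A,\ x\neq y\}>0$, and relatively dense if there is $R>0$ such that every ball of radius $R$ intersects $A$. *)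

theory Defs
  imports "HOL-Analysis.Analysis" "HOL-Library.Nonpos_Ints"
begin

section \<open>Complex, locally finite measures\<close>

text \<open>
  A complex, locally finite measure need not assign a value to unbounded sets, so it is a set
  function whose values matter only on the bounded Borel sets, where it is countably additive.
  Finiteness of the total variation on bounded sets is a consequence, as for every complex measure.
\<close>

definition complex_measure :: "('a::euclidean_space set \<Rightarrow> complex) \<Rightarrow> bool" where
  "complex_measure \<mu> \<longleftrightarrow>
     (\<forall>A::nat \<Rightarrow> 'a set. range A \<subseteq> sets borel \<longrightarrow> disjoint_family A \<longrightarrow> bounded (\<Union>i. A i) \<longrightarrow>
        (\<lambda>i. \<mu> (A i)) sums \<mu> (\<Union>i. A i))"

definition total_variation :: "('a::euclidean_space set \<Rightarrow> complex) \<Rightarrow> 'a set \<Rightarrow> ennreal" where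
  "total_variation \<mu> E =
     (SUP P \<in> {P. finite P \<and> disjoint P \<and> (\<forall>A\<in>P. A \<in> sets borel \<and> bounded A \<and> A \<subseteq> E)}.
        \<Sum>A\<in>P. ennreal (norm (\<mu> A)))"

definition variation_measure :: "('a::euclidean_space set \<Rightarrow> complex) \<Rightarrow> 'a measure" where
  "variation_measure \<mu> = measure_of UNIV (sets borel) (total_variation \<mu>)"

definition slowly_increasing :: "('a::euclidean_space set \<Rightarrow> complex) \<Rightarrow> bool" where
  "slowly_increasing \<mu> \<longleftrightarrow>
     complex_measure \<mu> \<and>
     (\<exists>(N::nat) (C::real). eventually (\<lambda>R. total_variation \<mu> (ball 0 R) \<le> ennreal (C * R ^ N)) at_top)"

text \<open>
  Integration against a complex measure goes through the polar decomposition
  d\<mu> = h d|\<mu>| with |h| = 1, which exists by the Radon-Nikodym theorem; h is unique up to a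
  |\<mu>|-null set, so the integral does not depend on the choice.
\<close>

definition polar_density :: "('a::euclidean_space set \<Rightarrow> complex) \<Rightarrow> 'a \<Rightarrow> complex" where
  "polar_density \<mu> =
     (SOME h. h \<in> borel_measurable borel \<and> (\<forall>x. norm (h x) = 1) \<and>
        (\<forall>A\<in>sets borel. bounded A \<longrightarrow> \<mu> A = (LINT x:A|variation_measure \<mu>. h x)))"

definition cm_integral :: "('a::euclidean_space set \<Rightarrow> complex) \<Rightarrow> ('a \<Rightarrow> complex) \<Rightarrow> complex" where
  "cm_integral \<mu> f = (LINT x|variation_measure \<mu>. f x * polar_density \<mu> x)"

text \<open>\<open>\<mu> = (\<Sum>a\<in>A. \<mu>({a}) \<delta>\<^sub>a)\<close>, evaluated on bounded Borel sets; \<open>\<delta>\<^sub>a(E)\<close> is \<open>indicator E a\<close>.\<close>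

definition sum_of_atoms :: "('a::euclidean_space set \<Rightarrow> complex) \<Rightarrow> 'a set \<Rightarrow> bool" where
  "sum_of_atoms \<mu> A \<longleftrightarrow>
     (\<forall>E\<in>sets borel. bounded E \<longrightarrow> ((\<lambda>a. \<mu> {a} * indicator E a) has_sum \<mu> E) A)"

section \<open>Schwartz functions and the Fourier transform\<close>

definition partial_deriv :: "'n \<Rightarrow> (real ^ 'n::finite \<Rightarrow> complex) \<Rightarrow> real ^ 'n \<Rightarrow> complex" where
  "partial_deriv i f x = frechet_derivative f (at x) (axis i 1)"

text \<open>
  Requiring every iterated partial derivative to be differentiable everywhere makes \<open>f\<close> smooth.
\<close>

definition schwartz :: "(real ^ 'n::finite \<Rightarrow> complex) \<Rightarrow> bool" where
  "schwartz f \<longleftrightarrow>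
     (\<forall>is. (\<forall>x. fold partial_deriv is f differentiable at x) \<and>
           (\<forall>k::nat. bounded (range (\<lambda>x. norm x ^ k * norm (fold partial_deriv is f x)))))"

definition fourier :: "('a::euclidean_space \<Rightarrow> complex) \<Rightarrow> 'a \<Rightarrow> complex" where
  "fourier \<phi> t = (LINT x|lborel. \<phi> x * exp (- 2 * of_real pi * \<i> * of_real (t \<bullet> x)))"

definition fourier_distribution ::
  "('a::euclidean_space set \<Rightarrow> complex) \<Rightarrow> ('a \<Rightarrow> complex) \<Rightarrow> complex" where
  "fourier_distribution \<mu> \<phi> = cm_integral \<mu> (fourier \<phi>)"

definition fourier_transform_is ::
  "((real ^ 'n::finite) set \<Rightarrow> complex) \<Rightarrow> ((real ^ 'n) set \<Rightarrow> complex) \<Rightarrow> bool" where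
  "fourier_transform_is \<mu> \<nu> \<longleftrightarrow>
     (\<forall>\<phi>. schwartz \<phi> \<longrightarrow> fourier_distribution \<mu> \<phi> = cm_integral \<nu> \<phi>)"

definition positive_definite :: "((real ^ 'n::finite) set \<Rightarrow> complex) \<Rightarrow> bool" where
  "positive_definite \<mu> \<longleftrightarrow>
     (\<forall>\<phi>. schwartz \<phi> \<longrightarrow> (\<forall>x. \<phi> x \<in> \<real>\<^sub>\<ge>\<^sub>0) \<longrightarrow> fourier_distribution \<mu> \<phi> \<in> \<real>\<^sub>\<ge>\<^sub>0)"

section \<open>Relatively dense sets\<close>

definition relatively_dense :: "'a::metric_space set \<Rightarrow> bool" where
  "relatively_dense A \<longleftrightarrow> (\<exists>R>0. \<forall>x. ball x R \<inter> A \<noteq> {})"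

end

theory Submission
  imports Defs "HOL-Complex_Analysis.Complex_Analysis"
begin

text \<open>
  Let \<open>a s\<close> be the mass of \<open>\<mu>hat\<close> at \<open>s\<close>; it is nonnegative since \<open>\<mu>\<close> is positive-definite. Take a kernel
  \<open>L \<ge> 0\<close> with \<open>L 0 = 1\<close> whose Fourier transform is supported in a ball of radius at most the separation
  \<open>\<delta>\<close> of \<open>\<Lambda>\<close>. Recover \<open>a (s + h)\<close> as the limit of \<open>\<Sum>t\<in>S. a t * L (2 ^ k * (t - s - h))\<close>, which the
  Poisson formula turns into a trigonometric polynomial in \<open>s\<close> with frequencies in \<open>\<Lambda>\<close>. A second use of the
  Poisson formula then shows that \<open>\<Sum>s\<in>S. a s * a (s + h) * L (s - x)\<close> does not depend on \<open>x\<close>: two points of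
  \<open>\<Lambda>\<close> at distance less than \<open>\<delta>\<close> coincide. Replacing \<open>L\<close> by its dilate \<open>y \<mapsto> L (y / 2)\<close> multiplies this sum
  by \<open>2 ^ CARD('n)\<close>.

  If no \<open>s \<in> S\<close> with \<open>s + h \<in> S\<close> lay within distance \<open>R\<close> of \<open>x\<close>, then, as \<open>L y\<close> is much smaller than
  \<open>L (y / 2)\<close> for \<open>norm y \<ge> R\<close>, the sum would be smaller than itself. Here \<open>R\<close> depends only on \<open>\<delta>\<close> and the
  dimension, not on \<open>h\<close>. So if \<open>S\<close> is not uniformly discrete, every ball of a fixed radius contains pairs of
  points of \<open>S\<close> at arbitrarily small distance, hence infinitely many points of \<open>S\<close>.
\<close>

section \<open>A band-limited function of rapid decay\<close>

text \<open>
  The entire function \<open>\<Prod>j. sin (z / 2 ^ j) / (z / 2 ^ j)\<close>, \<open>j \<ge> 1\<close>, is bounded by \<open>exp \<bar>Im z\<bar>\<close> and decays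
  rapidly along the real axis, because each factor contributes one power of \<open>1 / z\<close>.
\<close>

definition csinc :: "complex \<Rightarrow> complex" where
  "csinc z = (if z = 0 then 1 else sin z / z)"

lemma csinc_0 [simp]: "csinc 0 = 1"
  by (simp add: csinc_def)

lemma csinc_times: "z * csinc z = sin z"
  by (simp add: csinc_def)

lemma csinc_of_real_Reals: "csinc (of_real x) \<in> \<real>"
  by (auto simp: csinc_def sin_of_real simp flip: of_real_divide)

text \<open>Away from 0 this is the difference quotient of \<open>sin\<close> at 0, and the value 1
  at 0 is the derivative of \<open>sin\<close> there, so the singularity is removable.\<close>

lemma holomorphic_csinc: "csinc holomorphic_on UNIV"
proof -
  have "(\<lambda>z. if z = 0 then deriv sin 0 else (sin z - sin 0) / (z - 0)) holomorphic_on (UNIV :: complex set)"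
    by (intro pole_lemma_open holomorphic_intros) auto
  moreover have "deriv sin (0::complex) = 1"
    by (rule DERIV_imp_deriv) (auto intro!: derivative_eq_intros)
  ultimately show ?thesis
    by (simp only: csinc_def[abs_def] sin_zero diff_zero)
qed

lemma holomorphic_csinc_scaled: "(\<lambda>z. csinc (z / c)) holomorphic_on A"
proof -
  have "(csinc \<circ> (\<lambda>z. z / c)) holomorphic_on A"
    by (rule holomorphic_on_compose_gen[OF _ holomorphic_csinc])
       (auto simp: divide_inverse intro!: holomorphic_intros)
  then show ?thesis by (simp add: o_def)
qed

lemma norm_cos_le_exp: "norm (cos z) \<le> exp \<bar>Im z\<bar>" for z :: complex
proof -
  have "norm (cos z) \<le> (norm (exp (\<i> * z)) + norm (exp (- \<i> * z))) / 2"
    unfolding cos_exp_eq using norm_triangle_ineq[of "exp (\<i> * z)" "exp (- (\<i> * z))"]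
    by (simp add: norm_divide)
  also have "\<dots> \<le> exp \<bar>Im z\<bar>"
    by (simp add: norm_exp_eq_Re) (smt (verit) exp_le_cancel_iff)
  finally show ?thesis .
qed

lemma norm_sin_le_exp: "norm (sin z) \<le> exp \<bar>Im z\<bar>" for z :: complex
proof -
  have "norm (sin z) \<le> (norm (exp (\<i> * z)) + norm (exp (- \<i> * z))) / 2"
    unfolding sin_exp_eq using norm_triangle_ineq4[of "exp (\<i> * z)" "exp (- (\<i> * z))"]
    by (simp add: norm_divide norm_mult)
  also have "\<dots> \<le> exp \<bar>Im z\<bar>"
    by (simp add: norm_exp_eq_Re) (smt (verit) exp_le_cancel_iff)
  finally show ?thesis .
qed

text \<open>Mean value inequality for \<open>sin\<close> on the segment from 0 to \<open>z\<close>: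
  its points \<open>w\<close> satisfy \<open>\<bar>Im w\<bar> \<le> \<bar>Im z\<bar>\<close>, which
  bounds the derivative \<open>cos\<close>.\<close>

lemma norm_csinc_le: "norm (csinc z) \<le> exp \<bar>Im z\<bar>"
proof (cases "z = 0")
  case False
  have "norm (sin z - sin 0) \<le> exp \<bar>Im z\<bar> * norm (z - 0)"
  proof (rule field_differentiable_bound[where S = "closed_segment 0 z" and f' = cos])
    fix w assume "w \<in> closed_segment 0 z"
    then obtain u where "0 \<le> u" "u \<le> 1" "w = u *\<^sub>R z"
      by (auto simp: closed_segment_def)
    then have "\<bar>Im w\<bar> \<le> \<bar>Im z\<bar>"
      by (simp add: abs_mult mult_left_le_one_le)
    then show "norm (cos w) \<le> exp \<bar>Im z\<bar>"
      using norm_cos_le_exp[of w] by (meson exp_le_cancel_iff order_trans)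
  qed (auto intro!: derivative_eq_intros)
  with False show ?thesis
    by (simp add: csinc_def norm_divide field_simps)
qed simp

section \<open>The infinite product: convergence, growth and decay\<close>

definition kprod :: "complex \<Rightarrow> complex" where
  "kprod z = lim (\<lambda>N. \<Prod>j<N. csinc (z / 2 ^ Suc j))"

text \<open>On a disc \<open>csinc z - 1\<close> is at most a multiple of \<open>norm z\<close>, so
  factor \<open>j\<close> differs from 1 by O(2^-j) uniformly and the Weierstrass M-test applies.
  Uniformity on discs is what makes the product entire.\<close>

lemma uniform_limit_kprod:
  "uniform_limit (cball 0 r) (\<lambda>N z. \<Prod>j<N. csinc (z / 2 ^ Suc j)) kprod sequentially"
proof -
  \<comment> \<open>For negative \<open>r\<close> the disc of radius \<open>r\<close> is empty;
    radius \<open>\<bar>r\<bar>\<close> always contains 0, from which \<open>0 \<le> B\<close> is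
    read off.\<close>
  obtain B where B: "\<And>z. z \<in> cball 0 \<bar>r\<bar> \<Longrightarrow> norm (deriv csinc z) \<le> B"
  proof -
    have "compact (deriv csinc ` cball 0 \<bar>r\<bar>)"
      using holomorphic_deriv[OF holomorphic_csinc open_UNIV]
      by (intro compact_continuous_image holomorphic_on_imp_continuous_on)
         (auto intro: holomorphic_on_subset)
    then have "bounded (deriv csinc ` cball 0 \<bar>r\<bar>)"
      by (rule compact_imp_bounded)
    then show ?thesis
      using that unfolding bounded_iff by blast
  qed
  have lip: "norm (csinc z - 1) \<le> B * norm z" if "z \<in> cball 0 \<bar>r\<bar>" for z
  proof -
    have "norm (csinc z - csinc 0) \<le> B * norm (z - 0)"
    proof (rule field_differentiable_bound[where S = "cball 0 \<bar>r\<bar>" and f' = "deriv csinc"])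
      fix w :: complex
      show "(csinc has_field_derivative deriv csinc w) (at w within cball 0 \<bar>r\<bar>)"
        by (rule holomorphic_derivI[OF holomorphic_csinc]) auto
    qed (use that B in auto)
    then show ?thesis by simp
  qed
  have B0: "0 \<le> B"
    using order_trans[OF norm_ge_zero B[of 0]] by simp
  have bd: "norm (csinc (z / 2 ^ Suc j) - 1) \<le> B * \<bar>r\<bar> * (1/2) ^ Suc j" if "z \<in> cball 0 r" for z j
  proof -
    have z: "norm z \<le> \<bar>r\<bar>" using that by auto
    have n: "norm (z / 2 ^ Suc j) = norm z * (1/2) ^ Suc j"
      by (simp add: norm_divide norm_power norm_mult power_divide)
    have le: "norm z * (1/2) ^ Suc j \<le> \<bar>r\<bar> * (1/2) ^ Suc j"
      using z by (intro mult_right_mono) auto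
    also have "\<dots> \<le> \<bar>r\<bar> * 1"
      by (intro mult_left_mono power_le_one) auto
    finally have "z / 2 ^ Suc j \<in> cball 0 \<bar>r\<bar>" using n by simp
    from lip[OF this] have "norm (csinc (z / 2 ^ Suc j) - 1) \<le> B * (norm z * (1/2) ^ Suc j)"
      unfolding n .
    also have "\<dots> \<le> B * (\<bar>r\<bar> * (1/2) ^ Suc j)"
      using le B0 by (intro mult_left_mono) auto
    finally show ?thesis by (simp add: mult.assoc)
  qed
  have "uniformly_convergent_on (cball 0 r) (\<lambda>N z. \<Sum>j<N. norm (csinc (z / 2 ^ Suc j) - 1))"
    using bd by (intro Weierstrass_m_test'[where M = "\<lambda>j. B * \<bar>r\<bar> * (1/2) ^ Suc j"])
       (auto intro!: summable_mult)
  then have "uniformly_convergent_on (cball 0 r) (\<lambda>N z. \<Prod>j<N. csinc (z / 2 ^ Suc j))"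
    by (intro uniformly_convergent_on_prod' holomorphic_on_imp_continuous_on holomorphic_csinc_scaled) auto
  then show ?thesis
    by (simp add: uniformly_convergent_uniform_limit_iff kprod_def[abs_def])
qed

lemma kprod_LIMSEQ: "(\<lambda>N. \<Prod>j<N. csinc (z / 2 ^ Suc j)) \<longlonglongrightarrow> kprod z"
  using tendsto_uniform_limitI[OF uniform_limit_kprod[of "norm z"], of z] by simp

lemma holomorphic_kprod: "kprod holomorphic_on UNIV"
proof (rule holomorphic_uniform_sequence[where f = "\<lambda>N z. \<Prod>j<N. csinc (z / 2 ^ Suc j)"])
  fix x :: complex
  have "cball x 1 \<subseteq> cball 0 (norm x + 1)"
    by (auto simp: dist_norm) (smt (verit) norm_minus_commute norm_triangle_sub)
  then show "\<exists>d>0. cball x d \<subseteq> UNIV \<and>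
      uniform_limit (cball x d) (\<lambda>N z. \<Prod>j<N. csinc (z / 2 ^ Suc j)) kprod sequentially"
    using uniform_limit_on_subset[OF uniform_limit_kprod] by (intro exI[of _ 1]) auto
qed (auto intro!: holomorphic_intros holomorphic_csinc_scaled simp del: power_Suc)

lemma kprod_0: "kprod 0 = 1"
  using LIMSEQ_unique[OF kprod_LIMSEQ[of 0]] by simp

lemma kprod_of_real_Reals: "kprod (of_real x) \<in> \<real>"
proof (rule closed_sequentially[OF closed_complex_Reals _ kprod_LIMSEQ])
  fix N
  have "csinc (of_real x / 2 ^ Suc j) \<in> \<real>" for j
    using csinc_of_real_Reals[of "x / 2 ^ Suc j"] by simp
  then show "(\<Prod>j<N. csinc (of_real x / 2 ^ Suc j)) \<in> \<real>"
    by (intro prod_in_Reals) 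
qed

text \<open>Doubling the argument turns the factor of index 0 into \<open>csinc z\<close> and shifts
  the others by one index. Both the decay of \<open>kprod\<close> and the comparison of kernels at
  scales \<open>c\<close> and \<open>2 * c\<close> rest on this identity.\<close>

lemma kprod_double: "kprod (2 * z) = csinc z * kprod z"
proof -
  have "(\<lambda>N. \<Prod>j<Suc N. csinc (2 * z / 2 ^ Suc j)) \<longlonglongrightarrow> kprod (2 * z)"
    using kprod_LIMSEQ[of "2 * z"] by (rule LIMSEQ_Suc)
  moreover have "(\<lambda>N. \<Prod>j<Suc N. csinc (2 * z / 2 ^ Suc j)) \<longlonglongrightarrow> csinc z * kprod z"
    unfolding prod.lessThan_Suc_shift using kprod_LIMSEQ[of z]
    by (auto intro!: tendsto_intros simp: mult.commute)
  ultimately show ?thesis by (rule LIMSEQ_unique)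
qed

text \<open>Factor \<open>j\<close> contributes the exponent
  \<open>\<bar>Im z\<bar> / 2 ^ Suc j\<close>, and these exponents add up to at most
  \<open>\<bar>Im z\<bar>\<close>.\<close>

lemma norm_kprod_le: "norm (kprod z) \<le> exp \<bar>Im z\<bar>"
proof (rule LIMSEQ_le_const2[OF tendsto_norm[OF kprod_LIMSEQ]])
  have "norm (\<Prod>j<N. csinc (z / 2 ^ Suc j)) \<le> exp \<bar>Im z\<bar>" for N
  proof -
    have "norm (\<Prod>j<N. csinc (z / 2 ^ Suc j)) \<le> (\<Prod>j<N. exp (\<bar>Im z\<bar> * (1/2) ^ Suc j))"
      unfolding prod_norm[symmetric]
    proof (intro prod_mono conjI)
      fix j
      have "Im (z / 2 ^ Suc j) = Im z / 2 ^ Suc j"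
        by (metis Im_divide_of_real of_real_numeral of_real_power)
      then show "norm (csinc (z / 2 ^ Suc j)) \<le> exp (\<bar>Im z\<bar> * (1/2) ^ Suc j)"
        using norm_csinc_le[of "z / 2 ^ Suc j"] by (simp add: power_divide abs_mult)
    qed auto
    also have "\<dots> = exp (\<bar>Im z\<bar> * (\<Sum>j<N. (1/2) ^ Suc j))"
      by (simp add: exp_sum sum_distrib_left)
    also have "(\<Sum>j<N. (1/2) ^ Suc j) = (1::real) - (1/2) ^ N"
      by (induction N) (auto simp: field_simps)
    also have "exp (\<bar>Im z\<bar> * (1 - (1/2) ^ N)) \<le> exp \<bar>Im z\<bar>"
      by (simp add: mult_left_le)
    finally show ?thesis .
  qed
  then show "\<exists>N. \<forall>n\<ge>N. norm (\<Prod>j<n. csinc (z / 2 ^ Suc j)) \<le> exp \<bar>Im z\<bar>" by blast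
qed

text \<open>Halving the argument trades one power of \<open>z\<close> for a sine: with
  \<open>w = z / 2\<close>, \<open>z * kprod z = 2 * sin w * kprod w\<close>. The sine and the
  induction hypothesis each cost \<open>exp \<bar>Im w\<bar>\<close>, together exactly
  \<open>exp \<bar>Im z\<bar>\<close>, so the exponential type does not grow with
  \<open>m\<close>.\<close>

lemma kprod_decay: "norm z ^ m * norm (kprod z) \<le> 2 ^ (m * m) * exp \<bar>Im z\<bar>"
proof (induction m arbitrary: z)
  case 0
  show ?case using norm_kprod_le by simp
next
  case (Suc m)
  define w where "w = z / 2"
  have z: "z = 2 * w" by (simp add: w_def)
  have "norm z ^ Suc m * norm (kprod z) =
      2 ^ Suc m * norm (sin w) * (norm w ^ m * norm (kprod w))"
    by (simp add: z kprod_double norm_mult power_mult_distrib flip: csinc_times)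
  also have "\<dots> \<le> 2 ^ Suc m * exp \<bar>Im w\<bar> * (2 ^ (m * m) * exp \<bar>Im w\<bar>)"
    by (intro mult_mono Suc norm_sin_le_exp) auto
  also have "\<dots> = 2 ^ (Suc m + m * m) * exp \<bar>Im z\<bar>"
    by (simp add: z abs_mult power_add mult_exp_exp)
  also have "\<dots> \<le> 2 ^ (Suc m * Suc m) * exp \<bar>Im z\<bar>"
    by (intro mult_right_mono power_increasing) auto
  finally show ?case .
qed

section \<open>Entire functions of exponential type with rapid decay\<close>

text \<open>For \<open>\<tau> > 0\<close> these are, by the Paley-Wiener theorem, the
  Fourier-Laplace transforms of smooth functions supported in the interval from
  \<open>- \<tau> / (2 * pi)\<close> to \<open>\<tau> / (2 * pi)\<close>. The constant may depend on
  \<open>m\<close>, but the type \<open>\<tau>\<close> is the same for all \<open>m\<close>.\<close>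

definition paley_wiener :: "real \<Rightarrow> (complex \<Rightarrow> complex) \<Rightarrow> bool" where
  "paley_wiener \<tau> f \<longleftrightarrow> f holomorphic_on UNIV \<and>
     (\<forall>m::nat. \<exists>C. \<forall>z. norm z ^ m * norm (f z) \<le> C * exp (\<tau> * \<bar>Im z\<bar>))"

lemma paley_wienerD:
  assumes "paley_wiener \<tau> f"
  obtains C where "C \<ge> 0" "\<And>z. norm z ^ m * norm (f z) \<le> C * exp (\<tau> * \<bar>Im z\<bar>)"
proof -
  obtain C where C: "\<And>z. norm z ^ m * norm (f z) \<le> C * exp (\<tau> * \<bar>Im z\<bar>)"
    using assms unfolding paley_wiener_def by blast
  have "0 \<le> norm (0::complex) ^ m * norm (f 0)" by simp
  also have "\<dots> \<le> C" using C[of 0] by simp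
  finally show ?thesis using C that by blast
qed

text \<open>The weight \<open>1 + norm z\<close> is at least 1 and changes by a bounded factor under
  bounded translations, so in this form the estimate passes to neighbouring points and
  translates.\<close>

lemma paley_wiener_bound:
  assumes "paley_wiener \<tau> f"
  obtains C where "C \<ge> 0" "\<And>z. (1 + norm z) ^ m * norm (f z) \<le> C * exp (\<tau> * \<bar>Im z\<bar>)"
proof -
  obtain C where C: "C \<ge> 0" "\<And>z. norm z ^ 0 * norm (f z) \<le> C * exp (\<tau> * \<bar>Im z\<bar>)"
    using paley_wienerD[OF assms] by blast
  obtain D where D: "D \<ge> 0" "\<And>z. norm z ^ m * norm (f z) \<le> D * exp (\<tau> * \<bar>Im z\<bar>)"
    using paley_wienerD[OF assms] by blast
  have "(1 + norm z) ^ m * norm (f z) \<le> (2 ^ m * (C + D)) * exp (\<tau> * \<bar>Im z\<bar>)" for z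
  proof -
    have "(1 + norm z) ^ m \<le> (2 * max 1 (norm z)) ^ m"
      by (intro power_mono) auto
    also have "\<dots> \<le> 2 ^ m * (1 + norm z ^ m)"
      by (auto simp: power_mult_distrib max_def)
    finally have "(1 + norm z) ^ m * norm (f z) \<le> 2 ^ m * (1 + norm z ^ m) * norm (f z)"
      by (rule mult_right_mono) simp
    also have "\<dots> = 2 ^ m * (norm z ^ 0 * norm (f z) + norm z ^ m * norm (f z))"
      by (simp add: algebra_simps)
    also have "\<dots> \<le> 2 ^ m * (C * exp (\<tau> * \<bar>Im z\<bar>) + D * exp (\<tau> * \<bar>Im z\<bar>))"
      by (intro mult_left_mono add_mono C D) auto
    finally show ?thesis by (simp add: algebra_simps)
  qed
  with C(1) D(1) show ?thesis
    by (intro that[of "2 ^ m * (C + D)"]) auto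
qed

text \<open>Cauchy's estimate on the unit circle around \<open>z\<close>: there
  \<open>\<bar>Im w\<bar>\<close> differs from \<open>\<bar>Im z\<bar>\<close> by at most 1, which
  costs the constant factor \<open>exp \<bar>\<tau>\<bar>\<close> and leaves the type
  unchanged.\<close>

lemma paley_wiener_deriv:
  assumes "paley_wiener \<tau> f"
  shows "paley_wiener \<tau> (deriv f)"
  unfolding paley_wiener_def
proof (intro conjI allI)
  have hol: "f holomorphic_on UNIV"
    using assms by (simp add: paley_wiener_def)
  then show "deriv f holomorphic_on UNIV"
    by (rule holomorphic_deriv) simp
  fix m
  obtain C where C: "C \<ge> 0" "\<And>z. (1 + norm z) ^ m * norm (f z) \<le> C * exp (\<tau> * \<bar>Im z\<bar>)"
    using paley_wiener_bound[OF assms] by blast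
  have "norm z ^ m * norm (deriv f z) \<le> C * exp \<bar>\<tau>\<bar> * exp (\<tau> * \<bar>Im z\<bar>)" for z
  \<comment> \<open>The Cauchy bound below divides by \<open>norm z ^ m\<close>; in the excluded
    case the left-hand side is 0.\<close>
  proof (cases "z = 0 \<and> m > 0")
    case True
    then show ?thesis using C(1) by (simp add: zero_power)
  next
    case False
    have "norm ((deriv ^^ 1) f z) \<le> fact 1 * (C * exp \<bar>\<tau>\<bar> * exp (\<tau> * \<bar>Im z\<bar>) / norm z ^ m) / 1 ^ 1"
    proof (rule Cauchy_inequality)
      show "f holomorphic_on ball z 1" "continuous_on (cball z 1) f"
        using hol holomorphic_on_subset holomorphic_on_imp_continuous_on by blast+
      fix w assume w: "norm (z - w) = 1"
      have zw: "norm z \<le> 1 + norm w"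
        using norm_triangle_sub[of z w] w by simp
      have "\<bar>\<bar>Im w\<bar> - \<bar>Im z\<bar>\<bar> \<le> 1"
        using abs_Im_le_cmod[of "z - w"] w by simp
      then have "\<bar>\<tau>\<bar> * \<bar>\<bar>Im w\<bar> - \<bar>Im z\<bar>\<bar> \<le> \<bar>\<tau>\<bar>"
        by (simp add: mult_left_le)
      then have "\<tau> * \<bar>Im w\<bar> \<le> \<bar>\<tau>\<bar> + \<tau> * \<bar>Im z\<bar>"
        using abs_ge_self[of "\<tau> * (\<bar>Im w\<bar> - \<bar>Im z\<bar>)"]
        unfolding abs_mult by (simp add: right_diff_distrib)
      then have e: "exp (\<tau> * \<bar>Im w\<bar>) \<le> exp \<bar>\<tau>\<bar> * exp (\<tau> * \<bar>Im z\<bar>)"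
        by (simp add: mult_exp_exp)
      have "norm z ^ m * norm (f w) \<le> (1 + norm w) ^ m * norm (f w)"
        using zw by (intro mult_right_mono power_mono) auto
      also have "\<dots> \<le> C * exp (\<tau> * \<bar>Im w\<bar>)" by (rule C)
      also have "\<dots> \<le> C * (exp \<bar>\<tau>\<bar> * exp (\<tau> * \<bar>Im z\<bar>))"
        by (intro mult_left_mono e C)
      finally show "norm (f w) \<le> C * exp \<bar>\<tau>\<bar> * exp (\<tau> * \<bar>Im z\<bar>) / norm z ^ m"
        using False by (cases "m = 0") (auto simp: field_simps)
    qed simp
    then show ?thesis
      using False by (cases "m = 0") (auto simp: field_simps)
  qed
  then show "\<exists>C. \<forall>z. norm z ^ m * norm (deriv f z) \<le> C * exp (\<tau> * \<bar>Im z\<bar>)" by blast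
qed

lemma paley_wiener_modulate:
  assumes "paley_wiener \<tau> f"
  shows "paley_wiener (\<tau> + \<bar>b\<bar>) (\<lambda>z. exp (\<i> * of_real b * z) * f z)"
  unfolding paley_wiener_def
proof (intro conjI allI)
  have hol: "f holomorphic_on UNIV"
    using assms by (simp add: paley_wiener_def)
  then show "(\<lambda>z. exp (\<i> * of_real b * z) * f z) holomorphic_on UNIV"
    by (intro holomorphic_intros)
  fix m
  obtain C where C: "C \<ge> 0" "\<And>z. norm z ^ m * norm (f z) \<le> C * exp (\<tau> * \<bar>Im z\<bar>)"
    using paley_wienerD[OF assms] by blast
  have "norm z ^ m * norm (exp (\<i> * of_real b * z) * f z) \<le> C * exp ((\<tau> + \<bar>b\<bar>) * \<bar>Im z\<bar>)" for z
  proof -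
    have "- (b * Im z) \<le> \<bar>b\<bar> * \<bar>Im z\<bar>"
      by (metis abs_ge_minus_self abs_mult)
    then have "norm (exp (\<i> * of_real b * z)) \<le> exp (\<bar>b\<bar> * \<bar>Im z\<bar>)"
      by (simp add: norm_exp_eq_Re)
    then have "norm (exp (\<i> * of_real b * z)) * (norm z ^ m * norm (f z))
        \<le> exp (\<bar>b\<bar> * \<bar>Im z\<bar>) * (C * exp (\<tau> * \<bar>Im z\<bar>))"
      by (intro mult_mono C) auto
    then show ?thesis
      by (simp add: norm_mult algebra_simps exp_add)
  qed
  then show "\<exists>C. \<forall>z. norm z ^ m * norm (exp (\<i> * of_real b * z) * f z)
      \<le> C * exp ((\<tau> + \<bar>b\<bar>) * \<bar>Im z\<bar>)" by blast
qed

lemma paley_wiener_affine: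
  assumes "paley_wiener \<tau> f" "c > 0"
  shows "paley_wiener (c * \<tau>) (\<lambda>z. f (of_real c * (z - of_real u)))"
  unfolding paley_wiener_def
proof (intro conjI allI)
  have hol: "f holomorphic_on UNIV"
    using assms by (simp add: paley_wiener_def)
  have "(f \<circ> (\<lambda>z. of_real c * (z - of_real u))) holomorphic_on UNIV"
    by (rule holomorphic_on_compose_gen[OF _ hol]) (auto intro!: holomorphic_intros)
  then show "(\<lambda>z. f (of_real c * (z - of_real u))) holomorphic_on UNIV"
    by (simp add: o_def)
  fix m
  obtain C where C: "C \<ge> 0" "\<And>z. (1 + norm z) ^ m * norm (f z) \<le> C * exp (\<tau> * \<bar>Im z\<bar>)"
    using paley_wiener_bound[OF assms(1)] by blast
  define B where "B = max (1 / c) \<bar>u\<bar>"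
  have B: "B \<ge> 0" by (simp add: B_def le_max_iff_disj)
  have "norm z ^ m * norm (f (of_real c * (z - of_real u))) \<le> B ^ m * C * exp ((c * \<tau>) * \<bar>Im z\<bar>)" for z
  proof -
    define w where "w = of_real c * (z - of_real u)"
    have "norm (w / of_real c) = norm w / c"
      using assms(2) by (simp add: norm_divide)
    moreover have "z = w / of_real c + of_real u"
      using assms(2) by (simp add: w_def)
    ultimately have "norm z \<le> norm w / c + \<bar>u\<bar>"
      by (metis norm_of_real norm_triangle_ineq)
    also have "\<dots> \<le> B * norm w + B * 1"
    proof (intro add_mono)
      have "norm w / c = (1 / c) * norm w" by simp
      also have "\<dots> \<le> B * norm w" by (intro mult_right_mono) (auto simp: B_def)
      finally show "norm w / c \<le> B * norm w" .
    qed (auto simp: B_def)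
    finally have "norm z ^ m \<le> (B * (1 + norm w)) ^ m"
      by (intro power_mono) (auto simp: algebra_simps)
    then have "norm z ^ m * norm (f w) \<le> (B * (1 + norm w)) ^ m * norm (f w)"
      by (rule mult_right_mono) simp
    also have "\<dots> = B ^ m * ((1 + norm w) ^ m * norm (f w))"
      by (simp add: power_mult_distrib)
    also have "\<dots> \<le> B ^ m * (C * exp (\<tau> * \<bar>Im w\<bar>))"
      using B by (intro mult_left_mono C) auto
    also have "\<bar>Im w\<bar> = c * \<bar>Im z\<bar>"
      using assms(2) by (simp add: w_def abs_mult)
    finally show ?thesis
      by (simp add: w_def algebra_simps)
  qed
  then show "\<exists>C. \<forall>z. norm z ^ m * norm (f (of_real c * (z - of_real u)))
      \<le> C * exp ((c * \<tau>) * \<bar>Im z\<bar>)" by blast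
qed

lemma paley_wiener_kprod_square: "paley_wiener 2 (\<lambda>z. (kprod z)\<^sup>2)"
  unfolding paley_wiener_def
proof (intro conjI allI)
  show "(\<lambda>z. (kprod z)\<^sup>2) holomorphic_on UNIV"
    by (intro holomorphic_intros holomorphic_kprod)
  fix m
  have "norm z ^ m * norm ((kprod z)\<^sup>2) \<le> 2 ^ (m * m) * exp (2 * \<bar>Im z\<bar>)" for z
  proof -
    have "norm z ^ m * norm ((kprod z)\<^sup>2) = (norm z ^ m * norm (kprod z)) * norm (kprod z)"
      by (simp add: norm_power power2_eq_square norm_mult)
    also have "\<dots> \<le> (2 ^ (m * m) * exp \<bar>Im z\<bar>) * exp \<bar>Im z\<bar>"
      by (intro mult_mono kprod_decay norm_kprod_le) auto
    finally show ?thesis by (simp add: mult.assoc mult_exp_exp)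
  qed
  then show "\<exists>C. \<forall>z. norm z ^ m * norm ((kprod z)\<^sup>2) \<le> C * exp (2 * \<bar>Im z\<bar>)" by blast
qed

section \<open>Integrals along horizontal lines and contour shifts\<close>

lemma integrable_inverse_one_plus_square: "integrable lborel (\<lambda>x::real. 1 / (1 + x\<^sup>2))"
proof -
  have half: "set_integrable lborel {0..} (\<lambda>x::real. 1 / (1 + x\<^sup>2))"
    unfolding set_integrable_def
  proof (rule integrableI_nn_integral_finite)
    have "(\<integral>\<^sup>+ x. ennreal (1 / (1 + x\<^sup>2)) * indicator {0..} x \<partial>lborel) = ennreal (pi / 2 - arctan 0)"
      by (rule nn_integral_FTC_atLeast)
         (auto intro!: DERIV_arctan tendsto_arctan_at_top simp flip: inverse_eq_divide)
    moreover have "(\<integral>\<^sup>+ x. ennreal (indicator {0..} x *\<^sub>R (1 / (1 + x\<^sup>2))) \<partial>lborel) =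
        (\<integral>\<^sup>+ x. ennreal (1 / (1 + x\<^sup>2)) * indicator {0..} x \<partial>lborel)"
      by (intro nn_integral_cong) (auto simp: indicator_def)
    ultimately show "(\<integral>\<^sup>+ x. ennreal (indicator {0..} x *\<^sub>R (1 / (1 + x\<^sup>2))) \<partial>lborel) = ennreal (pi / 2)"
      by simp
  qed auto
  have "set_integrable lborel {..0} (\<lambda>x::real. 1 / (1 + x\<^sup>2))"
    using half lborel_integrable_real_affine[of "\<lambda>x. indicator {0..} x *\<^sub>R (1 / (1 + x\<^sup>2))" "-1" 0]
    unfolding set_integrable_def by (simp add: indicator_def)
  from set_integrable_Un[OF half this] have "set_integrable lborel UNIV (\<lambda>x::real. 1 / (1 + x\<^sup>2))"
    by (rule back_subst[of "\<lambda>A. set_integrable lborel A _"]) auto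
  then show ?thesis by (simp add: set_integrable_def)
qed

lemma paley_wiener_continuous:
  assumes "paley_wiener \<tau> f"
  shows "continuous_on A f"
  using assms holomorphic_on_imp_continuous_on holomorphic_on_subset
  unfolding paley_wiener_def by blast

lemma paley_wiener_line_bound:
  assumes "paley_wiener \<tau> f"
  obtains C where "C \<ge> 0"
    "\<And>x y. norm (f (Complex x y)) \<le> C * exp (\<tau> * \<bar>y\<bar>) * (1 / (1 + x\<^sup>2))"
proof -
  obtain C where C: "C \<ge> 0" "\<And>z. (1 + norm z) ^ 2 * norm (f z) \<le> C * exp (\<tau> * \<bar>Im z\<bar>)"
    using paley_wiener_bound[OF assms] by blast
  have "norm (f (Complex x y)) \<le> C * exp (\<tau> * \<bar>y\<bar>) * (1 / (1 + x\<^sup>2))" for x y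
  proof -
    have "x\<^sup>2 \<le> (norm (Complex x y))\<^sup>2"
      by (simp add: cmod_power2)
    then have "1 + x\<^sup>2 \<le> (1 + norm (Complex x y)) ^ 2"
      by (simp add: power2_eq_square algebra_simps del: norm_complex_def) (smt (verit) norm_ge_zero)
    then have "(1 + x\<^sup>2) * norm (f (Complex x y)) \<le> (1 + norm (Complex x y)) ^ 2 * norm (f (Complex x y))"
      by (intro mult_right_mono) auto
    also have "\<dots> \<le> C * exp (\<tau> * \<bar>y\<bar>)"
      using C(2)[of "Complex x y"] by simp
    finally show ?thesis
      by (simp add: field_simps add_pos_nonneg)
  qed
  with C(1) that show ?thesis by blast
qed

lemma paley_wiener_integrable_line:
  assumes "paley_wiener \<tau> f"
  shows "integrable lborel (\<lambda>x. f (Complex x y))"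
proof -
  obtain C where C: "C \<ge> 0" "\<And>x y. norm (f (Complex x y)) \<le> C * exp (\<tau> * \<bar>y\<bar>) * (1 / (1 + x\<^sup>2))"
    using paley_wiener_line_bound[OF assms] by blast
  show ?thesis
  proof (rule Bochner_Integration.integrable_bound)
    show "integrable lborel (\<lambda>x. C * exp (\<tau> * \<bar>y\<bar>) * (1 / (1 + x\<^sup>2)))"
      by (intro integrable_mult_right integrable_inverse_one_plus_square)
    have "continuous_on UNIV (\<lambda>x. f (Complex x y))"
      by (rule continuous_on_compose2[OF paley_wiener_continuous[OF assms, of UNIV]])
         (auto intro!: continuous_intros simp: Complex_eq)
    then show "(\<lambda>x. f (Complex x y)) \<in> borel_measurable lborel"
      using borel_measurable_continuous_onI by simp
    show "AE x in lborel. norm (f (Complex x y)) \<le> norm (C * exp (\<tau> * \<bar>y\<bar>) * (1 / (1 + x\<^sup>2)))"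
      using C by (intro AE_I2 order_trans[OF C(2)]) simp
  qed
qed

lemma symmetric_integral_LIMSEQ:
  fixes g :: "real \<Rightarrow> 'a::{banach,second_countable_topology}"
  assumes "integrable lborel g"
  shows "(\<lambda>n. LINT x:{- real n..real n}|lborel. g x) \<longlonglongrightarrow> (LINT x|lborel. g x)"
  unfolding set_lebesgue_integral_def
proof (rule integral_dominated_convergence[where w = "\<lambda>x. norm (g x)"])
  show "AE x in lborel. (\<lambda>n. indicator {- real n..real n} x *\<^sub>R g x) \<longlonglongrightarrow> g x"
  proof (intro AE_I2 tendsto_eventually)
    fix x :: real
    have "eventually (\<lambda>n. n \<ge> nat \<lceil>\<bar>x\<bar>\<rceil>) sequentially"
      by (rule eventually_ge_at_top)
    then show "\<forall>\<^sub>F n in sequentially. indicator {- real n..real n} x *\<^sub>R g x = g x"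
      by eventually_elim (auto simp: indicator_def nat_ceiling_le_eq)
  qed
qed (use assms in \<open>auto intro!: AE_I2 simp: indicator_def borel_measurable_integrable\<close>)

text \<open>Cauchy's theorem on a long rectangle, expressed through a global primitive
  \<open>H\<close>: the horizontal integrals are differences of \<open>H\<close>, and the increments
  of \<open>H\<close> along the vertical sides at \<open>n\<close> and \<open>- n\<close> are O(1/n)
  by the decay of \<open>f\<close>.\<close>

lemma paley_wiener_integral_shift:
  assumes "paley_wiener \<tau> f"
  shows "(LINT x|lborel. f (Complex x y)) = (LINT x|lborel. f (of_real x))"
proof -
  have hol: "f holomorphic_on UNIV"
    using assms by (simp add: paley_wiener_def)
  obtain H where H: "\<And>z. (H has_field_derivative f z) (at z)"
    using holomorphic_convex_primitive'[OF convex_UNIV open_UNIV hol] by auto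
  obtain C where C: "C \<ge> 0" "\<And>z. norm z ^ 1 * norm (f z) \<le> C * exp (\<tau> * \<bar>Im z\<bar>)"
    using paley_wienerD[OF assms] by blast
  have seg: "(LINT x:{- real n..real n}|lborel. f (Complex x v)) =
      H (Complex (real n) v) - H (Complex (- real n) v)" for n v
    unfolding set_lebesgue_integral_def
  proof (rule integral_FTC_atLeastAtMost)
    show "((\<lambda>x. H (Complex x v)) has_vector_derivative f (Complex x v)) (at x within A)" for x A
    proof -
      have "((\<lambda>x. Complex x v) has_vector_derivative 1) (at x within A)"
        unfolding Complex_eq by (auto intro!: derivative_eq_intros has_vector_derivative_of_real simp: has_vector_derivative_def scaleR_conv_of_real)
      from field_vector_diff_chain_within[OF this has_field_derivative_at_within[OF H]]
      show ?thesis by (simp add: o_def)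
    qed
    show "continuous_on A (\<lambda>x. f (Complex x v))" for A
      by (rule continuous_on_compose2[OF paley_wiener_continuous[OF assms, of UNIV]])
         (auto intro!: continuous_intros simp: Complex_eq)
  qed simp
  have side: "norm (H (Complex r y) - H (Complex r 0)) \<le> C * exp (\<bar>\<tau>\<bar> * \<bar>y\<bar>) / \<bar>r\<bar> * \<bar>y\<bar>" if "r \<noteq> 0" for r
  proof -
    have "norm (H (Complex r y) - H (Complex r 0)) \<le>
        C * exp (\<bar>\<tau>\<bar> * \<bar>y\<bar>) / \<bar>r\<bar> * norm (Complex r y - Complex r 0)"
    proof (rule field_differentiable_bound[where S = "closed_segment (Complex r 0) (Complex r y)"])
      fix z assume "z \<in> closed_segment (Complex r 0) (Complex r y)"
      then obtain u where u: "0 \<le> u" "u \<le> 1" and z: "z = Complex r (u * y)"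
        by (auto simp: closed_segment_def complex_eq_iff algebra_simps)
      have iz: "\<bar>Im z\<bar> \<le> \<bar>y\<bar>"
        using u by (simp add: z abs_mult mult_left_le_one_le)
      have rz: "\<bar>r\<bar> \<le> norm z"
        using abs_Re_le_cmod[of z] by (simp add: z)
      have "\<tau> * \<bar>Im z\<bar> \<le> \<bar>\<tau>\<bar> * \<bar>y\<bar>"
        using iz by (intro mult_mono) auto
      then have "C * exp (\<tau> * \<bar>Im z\<bar>) \<le> C * exp (\<bar>\<tau>\<bar> * \<bar>y\<bar>)"
        using C(1) by (intro mult_left_mono) auto
      moreover have "\<bar>r\<bar> * norm (f z) \<le> norm z * norm (f z)"
        using rz by (intro mult_right_mono) auto
      ultimately have "\<bar>r\<bar> * norm (f z) \<le> C * exp (\<bar>\<tau>\<bar> * \<bar>y\<bar>)"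
        using C(2)[of z] by simp
      then show "norm (f z) \<le> C * exp (\<bar>\<tau>\<bar> * \<bar>y\<bar>) / \<bar>r\<bar>"
        using that by (simp add: field_simps)
    qed (auto intro!: has_field_derivative_at_within H)
    also have "norm (Complex r y - Complex r 0) = \<bar>y\<bar>"
      by (simp add: cmod_def)
    finally show ?thesis .
  qed
  define I where "I v n = (LINT x:{- real n..real n}|lborel. f (Complex x v))" for v n
  have lim: "I v \<longlonglongrightarrow> (LINT x|lborel. f (Complex x v))" for v
    unfolding I_def by (rule symmetric_integral_LIMSEQ[OF paley_wiener_integrable_line[OF assms]])
  have "(\<lambda>n. I y n - I 0 n) \<longlonglongrightarrow> 0"
  proof (rule Lim_null_comparison)
    show "\<forall>\<^sub>F n in sequentially. norm (I y n - I 0 n) \<le> 2 * (C * exp (\<bar>\<tau>\<bar> * \<bar>y\<bar>) * \<bar>y\<bar>) / real n"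
      using eventually_gt_at_top[of 0]
    proof eventually_elim
      case (elim n)
      have "I y n - I 0 n = (H (Complex (real n) y) - H (Complex (real n) 0)) -
          (H (Complex (- real n) y) - H (Complex (- real n) 0))"
        by (simp add: I_def seg)
      also have "norm \<dots> \<le> C * exp (\<bar>\<tau>\<bar> * \<bar>y\<bar>) / \<bar>real n\<bar> * \<bar>y\<bar> + C * exp (\<bar>\<tau>\<bar> * \<bar>y\<bar>) / \<bar>- real n\<bar> * \<bar>y\<bar>"
        using elim by (intro order_trans[OF norm_triangle_ineq4] add_mono side) auto
      finally show ?case by (simp add: field_simps)
    qed
    show "(\<lambda>n. 2 * (C * exp (\<bar>\<tau>\<bar> * \<bar>y\<bar>) * \<bar>y\<bar>) / real n) \<longlonglongrightarrow> 0"
      by (rule lim_const_over_n)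
  qed
  moreover have "(\<lambda>n. I y n - I 0 n) \<longlonglongrightarrow> (LINT x|lborel. f (Complex x y)) - (LINT x|lborel. f (Complex x 0))"
    by (intro tendsto_diff lim)
  ultimately have "(LINT x|lborel. f (Complex x y)) - (LINT x|lborel. f (Complex x 0)) = 0"
    by (rule LIMSEQ_unique[symmetric])
  then show ?thesis by (simp add: complex_of_real_def)
qed

text \<open>Shift the line of integration to height \<open>n\<close> or \<open>- n\<close>, with the
  sign for which the modulation has modulus \<open>exp (- \<bar>b\<bar> * n)\<close>. As
  \<open>\<tau> < \<bar>b\<bar>\<close>, this beats the growth \<open>exp (\<tau> * n)\<close> of
  \<open>f\<close>, and \<open>n\<close> tends to infinity.\<close>

lemma fourier_paley_wiener_eq_0:
  assumes f: "paley_wiener \<tau> f" and t: "\<tau> < 2 * pi * \<bar>t\<bar>"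
  shows "fourier (\<lambda>x. f (of_real x)) t = 0"
proof -
  define b where "b = - (2 * pi * t)"
  define F where "F z = exp (\<i> * of_real b * z) * f z" for z
  have b: "\<tau> < \<bar>b\<bar>" using t by (simp add: b_def abs_mult)
  have F: "paley_wiener (\<tau> + \<bar>b\<bar>) F"
    unfolding F_def by (rule paley_wiener_modulate[OF f])
  obtain C where C: "C \<ge> 0" "\<And>x y. norm (f (Complex x y)) \<le> C * exp (\<tau> * \<bar>y\<bar>) * (1 / (1 + x\<^sup>2))"
    using paley_wiener_line_bound[OF f] by blast
  define J where "J = (LINT x|lborel. 1 / (1 + x\<^sup>2::real))"
  have bound: "norm (LINT x|lborel. F (of_real x)) \<le> C * J * exp ((\<tau> - \<bar>b\<bar>) * real n)" for n
  proof -
    define y where "y = (if b \<ge> 0 then real n else - real n)"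
    have b_y: "b * y = \<bar>b\<bar> * real n"
      by (simp add: y_def)
    have ay: "\<bar>y\<bar> = real n"
      by (simp add: y_def)
    have "(LINT x|lborel. F (of_real x)) = (LINT x|lborel. F (Complex x y))"
      using paley_wiener_integral_shift[OF F] by simp
    also have "norm \<dots> \<le> (LINT x|lborel. C * exp ((\<tau> - \<bar>b\<bar>) * real n) * (1 / (1 + x\<^sup>2)))"
    proof (rule Bochner_Integration.integral_norm_bound_integral)
      fix x
      have "norm (F (Complex x y)) = exp (- (\<bar>b\<bar> * real n)) * norm (f (Complex x y))"
        by (simp add: F_def norm_mult norm_exp_eq_Re b_y)
      also have "\<dots> \<le> exp (- (\<bar>b\<bar> * real n)) * (C * exp (\<tau> * \<bar>y\<bar>) * (1 / (1 + x\<^sup>2)))"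
        by (intro mult_left_mono C) auto
      finally show "norm (F (Complex x y)) \<le> C * exp ((\<tau> - \<bar>b\<bar>) * real n) * (1 / (1 + x\<^sup>2))"
        by (simp add: ay left_diff_distrib exp_diff exp_minus field_simps)
    qed (intro paley_wiener_integrable_line[OF F] integrable_mult_right integrable_inverse_one_plus_square)+
    also have "\<dots> = C * J * exp ((\<tau> - \<bar>b\<bar>) * real n)"
      unfolding J_def by (subst integral_mult_right_zero) (simp only: mult_ac)
    finally show ?thesis .
  qed
  have "(\<lambda>n. C * J * exp ((\<tau> - \<bar>b\<bar>) * real n)) \<longlonglongrightarrow> C * J * 0"
  proof (intro tendsto_mult_left)
    have "(\<lambda>n. exp (\<tau> - \<bar>b\<bar>) ^ n) \<longlonglongrightarrow> 0"
      using b by (intro LIMSEQ_power_zero) simp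
    then show "(\<lambda>n. exp ((\<tau> - \<bar>b\<bar>) * real n)) \<longlonglongrightarrow> 0"
      by (simp add: exp_of_nat2_mult)
  qed
  then have "norm (LINT x|lborel. F (of_real x)) \<le> 0"
    using bound by (intro LIMSEQ_le_const[of _ "C * J * 0", simplified]) auto
  moreover have "fourier (\<lambda>x. f (of_real x)) t = (LINT x|lborel. F (of_real x))"
    unfolding fourier_def F_def b_def by (intro Bochner_Integration.integral_cong) (auto simp: mult_ac)
  ultimately show ?thesis by simp
qed

section \<open>Tensor products are Schwartz functions\<close>

lemma one_plus_sum_le_prod:
  fixes f :: "'a \<Rightarrow> real"
  assumes "\<And>i. i \<in> A \<Longrightarrow> f i \<ge> 0"
  shows "1 + sum f A \<le> (\<Prod>i\<in>A. 1 + f i)"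
  using assms
proof (induction A rule: infinite_finite_induct)
  case (insert a A)
  have "1 + sum f A \<le> (\<Prod>i\<in>A. 1 + f i)" using insert by simp
  moreover have "0 \<le> f a * sum f A" using insert by (intro mult_nonneg_nonneg sum_nonneg) auto
  ultimately have "(1 + f a) * (1 + sum f A) \<le> (1 + f a) * (\<Prod>i\<in>A. 1 + f i)"
    using insert.prems by (intro mult_left_mono) auto
  then show ?case using insert \<open>0 \<le> f a * sum f A\<close> by (simp add: algebra_simps)
qed auto

text \<open>The factors are kept as functions of a complex variable, although only real points are
  evaluated, so that partial derivatives act through \<open>deriv\<close> and stay within the
  Paley-Wiener class.\<close>

definition tensor :: "('n::finite \<Rightarrow> complex \<Rightarrow> complex) \<Rightarrow> real ^ 'n \<Rightarrow> complex" where
  "tensor f x = (\<Prod>i\<in>UNIV. f i (of_real (x $ i)))"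

lemma has_derivative_tensor:
  fixes f :: "'n::finite \<Rightarrow> complex \<Rightarrow> complex"
  assumes "\<And>i. f i holomorphic_on UNIV"
  shows "(tensor f has_derivative (\<lambda>h. \<Sum>i\<in>UNIV. deriv (f i) (of_real (x $ i)) * of_real (h $ i) *
    (\<Prod>j\<in>UNIV - {i}. f j (of_real (x $ j))))) (at x)"
  unfolding tensor_def[abs_def]
proof (rule has_derivative_prod)
  fix i :: 'n
  have 1: "(f i has_derivative (*) (deriv (f i) (of_real (x $ i)))) (at (of_real (x $ i)))"
    using holomorphic_derivI[OF assms[of i] open_UNIV UNIV_I] by (simp add: has_field_derivative_def)
  have 2: "((\<lambda>x. complex_of_real (x $ i)) has_derivative (\<lambda>h. of_real (h $ i))) (at x)"
    by (intro bounded_linear_imp_has_derivative bounded_linear_compose[OF bounded_linear_of_real bounded_linear_vec_nth])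
  show "((\<lambda>x. f i (of_real (x $ i))) has_derivative
      (\<lambda>h. deriv (f i) (of_real (x $ i)) * of_real (h $ i))) (at x)"
    by (rule has_derivative_compose[OF 2 1])
qed

lemma partial_deriv_tensor:
  fixes f :: "'n::finite \<Rightarrow> complex \<Rightarrow> complex"
  assumes "\<And>i. f i holomorphic_on UNIV"
  shows "partial_deriv k (tensor f) = tensor (f(k := deriv (f k)))"
proof
  fix x :: "real ^ 'n"
  have "partial_deriv k (tensor f) x =
      (\<Sum>i\<in>UNIV. deriv (f i) (of_real (x $ i)) * of_real (axis k 1 $ i) * (\<Prod>j\<in>UNIV - {i}. f j (of_real (x $ j))))"
    unfolding partial_deriv_def frechet_derivative_at[OF has_derivative_tensor[OF assms], symmetric] ..
  also have "\<dots> = (\<Sum>i\<in>{k}. deriv (f i) (of_real (x $ i)) * (\<Prod>j\<in>UNIV - {i}. f j (of_real (x $ j))))"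
    by (intro sum.mono_neutral_cong_right) (auto simp: axis_def)
  also have "\<dots> = deriv (f k) (of_real (x $ k)) * (\<Prod>j\<in>UNIV - {k}. (f(k := deriv (f k))) j (of_real (x $ j)))"
    by (simp cong: prod.cong_simp)
  also have "\<dots> = tensor (f(k := deriv (f k))) x"
    unfolding tensor_def by (subst prod.remove[of UNIV k]) auto
  finally show "partial_deriv k (tensor f) x = tensor (f(k := deriv (f k))) x" .
qed

lemma fold_partial_deriv_tensor:
  fixes f :: "'n::finite \<Rightarrow> complex \<Rightarrow> complex"
  assumes "\<And>i. \<exists>\<tau>. paley_wiener \<tau> (f i)"
  obtains g where "\<And>i. \<exists>\<tau>. paley_wiener \<tau> (g i)" "fold partial_deriv ks (tensor f) = tensor g"
proof -
  have "\<exists>g. (\<forall>i. \<exists>\<tau>. paley_wiener \<tau> (g i)) \<and> fold partial_deriv ks (tensor f) = tensor g"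
    using assms
  proof (induction ks arbitrary: f)
    case (Cons k ks)
    have eq: "partial_deriv k (tensor f) = tensor (f(k := deriv (f k)))"
      using Cons.prems by (intro partial_deriv_tensor) (auto simp: paley_wiener_def)
    have "\<exists>\<tau>. paley_wiener \<tau> ((f(k := deriv (f k))) i)" for i
      using Cons.prems[of i] paley_wiener_deriv by auto
    from Cons.IH[of "f(k := deriv (f k))", OF this] show ?case
      by (simp only: fold_simps eq)
  qed auto
  then show ?thesis using that by blast
qed

text \<open>\<open>norm x\<close> is at most the sum of the \<open>\<bar>x $ i\<bar>\<close>, hence
  at most the product of the \<open>1 + \<bar>x $ i\<bar>\<close>; the estimate then splits into
  one-variable estimates.\<close>

lemma bounded_tensor:
  fixes f :: "'n::finite \<Rightarrow> complex \<Rightarrow> complex"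
  assumes "\<And>i. \<exists>\<tau>. paley_wiener \<tau> (f i)"
  shows "bounded (range (\<lambda>x. norm x ^ k * norm (tensor f x)))"
proof -
  have "\<exists>C. \<forall>r::real. (1 + \<bar>r\<bar>) ^ k * norm (f i (of_real r)) \<le> C" for i
  proof -
    obtain \<tau> where "paley_wiener \<tau> (f i)" using assms by blast
    then obtain C where "\<And>z. (1 + norm z) ^ k * norm (f i z) \<le> C * exp (\<tau> * \<bar>Im z\<bar>)"
      using paley_wiener_bound by blast
    from this[of "of_real _"] show ?thesis by auto
  qed
  then obtain C where C: "\<And>i r. (1 + \<bar>r\<bar>) ^ k * norm (f i (of_real r)) \<le> C i"
    by metis
  have "norm (norm x ^ k * norm (tensor f x)) \<le> (\<Prod>i\<in>UNIV. C i)" for x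
  proof -
    have "norm x \<le> (\<Sum>i\<in>UNIV. \<bar>x $ i\<bar>)"
      by (rule norm_le_l1_cart)
    also have "\<dots> \<le> (\<Prod>i\<in>UNIV. 1 + \<bar>x $ i\<bar>)"
      using one_plus_sum_le_prod[of UNIV "\<lambda>i. \<bar>x $ i\<bar>"] by simp
    finally have "norm x ^ k \<le> (\<Prod>i\<in>UNIV. 1 + \<bar>x $ i\<bar>) ^ k"
      by (rule power_mono) simp
    then have "norm x ^ k * norm (tensor f x) \<le> (\<Prod>i\<in>UNIV. 1 + \<bar>x $ i\<bar>) ^ k * norm (tensor f x)"
      by (rule mult_right_mono) simp
    also have "\<dots> = (\<Prod>i\<in>UNIV. (1 + \<bar>x $ i\<bar>) ^ k * norm (f i (of_real (x $ i))))"
      by (simp add: tensor_def prod_norm[symmetric] prod_power_distrib prod.distrib)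
    also have "\<dots> \<le> (\<Prod>i\<in>UNIV. C i)"
      by (intro prod_mono) (auto intro: C)
    finally show ?thesis by simp
  qed
  then show ?thesis by (auto simp: bounded_iff intro!: exI[of _ "\<Prod>i\<in>UNIV. C i"])
qed

lemma schwartz_tensor:
  fixes f :: "'n::finite \<Rightarrow> complex \<Rightarrow> complex"
  assumes "\<And>i. \<exists>\<tau>. paley_wiener \<tau> (f i)"
  shows "schwartz (tensor f)"
  unfolding schwartz_def
proof (intro allI conjI)
  fix "is" :: "'n list" and k and x :: "real ^ 'n"
  obtain g where g: "\<And>i. \<exists>\<tau>. paley_wiener \<tau> (g i)" "fold partial_deriv is (tensor f) = tensor g"
    by (rule fold_partial_deriv_tensor[of f "is", OF assms]) (rule that)
  show "fold partial_deriv is (tensor f) differentiable at x"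
    unfolding g(2)
  proof (rule differentiableI[OF has_derivative_tensor])
    show "g i holomorphic_on UNIV" for i
      using g(1)[of i] unfolding paley_wiener_def by blast
  qed
  show "bounded (range (\<lambda>x. norm x ^ k * norm (fold partial_deriv is (tensor f) x)))"
    unfolding g(2) by (rule bounded_tensor[OF g(1)])
qed

section \<open>Lebesgue integrals of products over the coordinates\<close>

lemma lborel_integral_prod_Basis:
  fixes g :: "'a::euclidean_space \<Rightarrow> real \<Rightarrow> 'b::{real_normed_field,banach,second_countable_topology}"
  assumes "\<And>b. b \<in> Basis \<Longrightarrow> integrable lborel (g b)"
  shows "(LINT x|lborel. (\<Prod>b\<in>Basis. g b (x \<bullet> b))) = (\<Prod>b\<in>Basis. (LINT r|lborel. g b r))"
proof -
  interpret product_sigma_finite "\<lambda>b::'a. lborel :: real measure" ..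
  have [measurable]: "g b \<in> borel_measurable borel" if "b \<in> Basis" for b
    using assms[OF that] borel_measurable_integrable by fastforce
  have "(LINT x|lborel. (\<Prod>b\<in>Basis. g b (x \<bullet> b))) =
      (LINT x|Pi\<^sub>M Basis (\<lambda>b. lborel). (\<Prod>b\<in>Basis. g b ((\<Sum>c\<in>Basis. x c *\<^sub>R c) \<bullet> b)))"
    by (subst lborel_eq, subst integral_distr) simp_all
  also have "\<dots> = (LINT x|Pi\<^sub>M Basis (\<lambda>b. lborel). (\<Prod>b\<in>Basis. g b (x b)))"
    by (intro Bochner_Integration.integral_cong prod.cong) (auto)
  also have "\<dots> = (\<Prod>b\<in>Basis. (LINT r|lborel. g b r))"
    by (rule product_integral_prod) (use assms in auto)
  finally show ?thesis .
qed

lemma prod_Basis_vec: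
  fixes g :: "'n::finite \<Rightarrow> 'c::comm_monoid_mult"
  shows "(\<Prod>b\<in>(Basis :: (real ^ 'n) set). g (axis_index b)) = (\<Prod>i\<in>UNIV. g i)"
proof -
  have "bij_betw (\<lambda>i. axis i 1) UNIV (Basis :: (real ^ 'n) set)"
    by (auto simp: bij_betw_def Basis_vec_def axis_eq_axis inj_on_def)
  then have "(\<Prod>b\<in>(Basis :: (real ^ 'n) set). g (axis_index b)) = (\<Prod>i\<in>UNIV. g (axis_index (axis i (1::real))))"
    by (rule prod.reindex_bij_betw[symmetric])
  moreover have "axis_index (axis i (1::real)) = i" for i :: 'n
    using axis_index[of "axis i (1::real)"] by (simp add: axis_eq_axis)
  ultimately show ?thesis by simp
qed

lemma lborel_integral_prod_vec:
  fixes g :: "'n::finite \<Rightarrow> real \<Rightarrow> complex"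
  assumes "\<And>i. integrable lborel (g i)"
  shows "(LINT x|lborel. (\<Prod>i\<in>UNIV. g i (x $ i))) = (\<Prod>i\<in>UNIV. (LINT r|lborel. g i r))"
proof -
  have nth: "x $ i = x \<bullet> axis i 1" for x :: "real ^ 'n" and i
    by (simp add: inner_axis)
  have "(LINT x|lborel. (\<Prod>i\<in>UNIV. g i (x $ i))) =
      (LINT x|lborel. (\<Prod>b\<in>(Basis::(real ^ 'n) set). g (axis_index b) (x \<bullet> b)))"
  proof (rule Bochner_Integration.integral_cong)
    fix x :: "real ^ 'n"
    have "(\<Prod>i\<in>UNIV. g i (x $ i)) = (\<Prod>b\<in>(Basis::(real ^ 'n) set). g (axis_index b) (x $ axis_index b))"
      by (rule prod_Basis_vec[symmetric])
    also have "\<dots> = (\<Prod>b\<in>(Basis::(real ^ 'n) set). g (axis_index b) (x \<bullet> b))"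
      by (intro prod.cong refl) (metis axis_index nth)
    finally show "(\<Prod>i\<in>UNIV. g i (x $ i)) = (\<Prod>b\<in>(Basis::(real ^ 'n) set). g (axis_index b) (x \<bullet> b))" .
  qed simp
  also have "\<dots> = (\<Prod>b\<in>(Basis::(real ^ 'n) set). (LINT r|lborel. g (axis_index b) r))"
    by (rule lborel_integral_prod_Basis) (rule assms)
  also have "\<dots> = (\<Prod>i\<in>UNIV. (LINT r|lborel. g i r))"
    by (rule prod_Basis_vec)
  finally show ?thesis .
qed

section \<open>The kernel and its Fourier transform\<close>

lemma paley_wiener_integrable_modulated:
  assumes "paley_wiener \<tau> f"
  shows "integrable lborel (\<lambda>x. f (of_real x) * exp (- 2 * of_real pi * \<i> * of_real (t * x)))"
proof -
  have "integrable lborel (\<lambda>x. exp (\<i> * of_real (- 2 * pi * t) * Complex x 0) * f (Complex x 0))"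
    by (rule paley_wiener_integrable_line[OF paley_wiener_modulate[OF assms]])
  then show ?thesis
    by (simp add: mult_ac flip: complex_of_real_def)
qed

lemma fourier_tensor:
  fixes f :: "'n::finite \<Rightarrow> complex \<Rightarrow> complex"
  assumes "\<And>i. \<exists>\<tau>. paley_wiener \<tau> (f i)"
  shows "fourier (tensor f) t = (\<Prod>i\<in>UNIV. fourier (\<lambda>r. f i (of_real r)) (t $ i))"
proof -
  have "tensor f x * exp (- 2 * of_real pi * \<i> * of_real (t \<bullet> x)) =
      (\<Prod>i\<in>UNIV. f i (of_real (x $ i)) * exp (- 2 * of_real pi * \<i> * of_real (t $ i * x $ i)))" for x
    by (simp add: tensor_def prod.distrib inner_vec_def sum_distrib_left exp_sum flip: sum_negf)
  then have "fourier (tensor f) t = (LINT x|lborel.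
      (\<Prod>i\<in>UNIV. f i (of_real (x $ i)) * exp (- 2 * of_real pi * \<i> * of_real (t $ i * x $ i))))"
    by (simp add: fourier_def)
  also have "\<dots> = (\<Prod>i\<in>UNIV. (LINT r|lborel. f i (of_real r) * exp (- 2 * of_real pi * \<i> * of_real (t $ i * r))))"
    using assms paley_wiener_integrable_modulated by (intro lborel_integral_prod_vec) blast
  finally show ?thesis
    by (simp add: fourier_def)
qed

text \<open>The square makes the kernel nonnegative; \<open>Re\<close> loses nothing because
  \<open>kprod\<close> is real on the real axis. A larger \<open>c\<close> means a narrower kernel
  and a wider Fourier transform.\<close>

definition kern :: "real \<Rightarrow> real ^ 'n::finite \<Rightarrow> real" where
  "kern c x = (\<Prod>i\<in>UNIV. (Re (kprod (of_real (c * x $ i))))\<^sup>2)"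

lemma of_real_kern:
  "complex_of_real (kern c x) = tensor (\<lambda>i z. (kprod (of_real c * z))\<^sup>2) x"
proof -
  have "of_real (Re (kprod (of_real r))) = kprod (of_real r)" for r :: real
    using kprod_of_real_Reals by (rule of_real_Re)
  from this[of "_ * _"] show ?thesis
    by (simp add: kern_def tensor_def)
qed

lemma kern_nonneg: "0 \<le> kern c x"
  by (simp add: kern_def prod_nonneg)

lemma continuous_on_kern [continuous_intros]:
  "continuous_on A g \<Longrightarrow> continuous_on A (\<lambda>x. kern c (g x))"
  unfolding kern_def
  by (intro continuous_intros continuous_on_compose2[OF holomorphic_on_imp_continuous_on[OF holomorphic_kprod]]) auto

lemma kern_0 [simp]: "kern c 0 = 1"
  by (simp add: kern_def kprod_0)

lemma kern_le_1: "kern c x \<le> 1"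
  unfolding kern_def
proof (intro prod_le_1 conjI)
  fix i
  have "\<bar>Re (kprod (of_real (c * x $ i)))\<bar> \<le> 1"
    using abs_Re_le_cmod[of "kprod (of_real (c * x $ i))"] norm_kprod_le[of "of_real (c * x $ i)"] by simp
  then show "(Re (kprod (of_real (c * x $ i))))\<^sup>2 \<le> 1"
    by (simp add: abs_square_le_1)
qed simp

lemma kern_double:
  "kern (2 * c) x = (\<Prod>i\<in>UNIV. (Re (csinc (of_real (c * x $ i))))\<^sup>2) * kern c x"
proof -
  have "Re (kprod (of_real (2 * c * r))) = Re (csinc (of_real (c * r))) * Re (kprod (of_real (c * r)))" for r
  proof -
    have "kprod (of_real (2 * c * r)) = csinc (of_real (c * r)) * kprod (of_real (c * r))"
      using kprod_double[of "of_real (c * r)"] by (simp add: mult.assoc)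
    then show ?thesis
      using csinc_of_real_Reals[of "c * r"] by (auto simp: complex_is_Real_iff)
  qed
  then show ?thesis
    by (simp add: kern_def prod.distrib power_mult_distrib)
qed

lemma csinc_of_real_le_1: "(Re (csinc (of_real r)))\<^sup>2 \<le> 1"
  using abs_Re_le_cmod[of "csinc (of_real r)"] norm_csinc_le[of "of_real r"]
  by (simp add: abs_square_le_1)

lemma kern_double_le: "kern (2 * c) x \<le> kern c x"
  unfolding kern_double by (intro mult_left_le_one_le kern_nonneg prod_le_1 prod_nonneg conjI csinc_of_real_le_1) auto

text \<open>The quotient of the two kernels is a product of squared sinc values, all at most 1; the
  one in coordinate \<open>i\<close> is at most \<open>1 / (c * x $ i)\<^sup>2\<close> because the
  sine is bounded by 1.\<close>

lemma kern_double_le_decay: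
  fixes x :: "real ^ 'n::finite"
  assumes "c > 0" "x $ i \<noteq> 0"
  shows "kern (2 * c) x \<le> 1 / (c * x $ i)\<^sup>2 * kern c x"
  unfolding kern_double
proof (intro mult_right_mono kern_nonneg)
  have "(\<Prod>j\<in>UNIV. (Re (csinc (of_real (c * x $ j))))\<^sup>2) =
      (Re (csinc (of_real (c * x $ i))))\<^sup>2 * (\<Prod>j\<in>UNIV - {i}. (Re (csinc (of_real (c * x $ j))))\<^sup>2)"
    by (rule prod.remove) auto
  also have "\<dots> \<le> (Re (csinc (of_real (c * x $ i))))\<^sup>2 * 1"
    by (intro mult_left_mono prod_le_1 conjI csinc_of_real_le_1) auto
  also have "csinc (of_real (c * x $ i)) = of_real (sin (c * x $ i) / (c * x $ i))"
    using assms sin_of_real[of "c * x $ i", where 'a = complex] by (simp add: csinc_def)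
  also have "(Re (of_real (sin (c * x $ i) / (c * x $ i))))\<^sup>2 * 1 \<le> 1 / (c * x $ i)\<^sup>2"
    by (simp add: power_divide divide_right_mono abs_square_le_1)
  finally show "(\<Prod>j\<in>UNIV. (Re (csinc (of_real (c * x $ j))))\<^sup>2) \<le> 1 / (c * x $ i)\<^sup>2" .
qed

lemma kern_power_antimono: "kern (2 ^ k * c) x \<le> kern c x"
proof (induction k)
  case (Suc k)
  have "kern (2 ^ Suc k * c) x \<le> kern (2 ^ k * c) x"
    using kern_double_le[of "2 ^ k * c" x] by (simp add: mult.assoc)
  with Suc show ?case by linarith
qed simp

text \<open>At a nonzero coordinate the doubling estimate at scale \<open>2 ^ k * c\<close> is of
  order 4^-k. It bounds the kernel of index \<open>Suc k\<close>, hence the shifted sequence in the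
  proof.\<close>

lemma kern_LIMSEQ:
  assumes "c > 0"
  shows "(\<lambda>k. kern (2 ^ k * c) x) \<longlonglongrightarrow> (if x = 0 then 1 else 0)"
proof (cases "x = 0")
  case False
  then obtain i where i: "x $ i \<noteq> 0" by (auto simp: vec_eq_iff)
  have "(\<lambda>k. kern (2 ^ Suc k * c) x) \<longlonglongrightarrow> 0"
  proof (rule tendsto_sandwich[OF _ _ tendsto_const])
    show "\<forall>\<^sub>F k in sequentially. 0 \<le> kern (2 ^ Suc k * c) x"
      by (simp add: kern_nonneg)
    show "\<forall>\<^sub>F k in sequentially. kern (2 ^ Suc k * c) x \<le> (1 / (c * x $ i)\<^sup>2) * ((1/4) ^ k)"
    proof (intro always_eventually allI)
      fix k
      have "kern (2 * (2 ^ k * c)) x \<le> 1 / (2 ^ k * c * x $ i)\<^sup>2 * kern (2 ^ k * c) x"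
        using assms i by (intro kern_double_le_decay) auto
      also have "\<dots> \<le> 1 / (2 ^ k * c * x $ i)\<^sup>2 * 1"
        by (intro mult_left_mono kern_le_1) auto
      also have "\<dots> = (1 / (c * x $ i)\<^sup>2) * ((1/4) ^ k)"
        by (simp add: power_mult_distrib power_divide flip: power_mult) (simp add: power_mult mult.commute[of k])
      finally show "kern (2 ^ Suc k * c) x \<le> (1 / (c * x $ i)\<^sup>2) * ((1/4) ^ k)"
        by (simp add: mult.assoc)
    qed
    show "(\<lambda>k. (1 / (c * x $ i)\<^sup>2) * ((1/4) ^ k)) \<longlonglongrightarrow> 0"
      by (intro tendsto_mult_right_zero LIMSEQ_power_zero) simp
  qed
  from LIMSEQ_imp_Suc[OF this] False show ?thesis by simp
qed simp

lemma paley_wiener_kern_factor: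
  assumes "c > 0"
  shows "paley_wiener (c * 2) (\<lambda>z. (kprod (of_real c * (z - of_real u)))\<^sup>2)"
  using paley_wiener_affine[OF paley_wiener_kprod_square assms, of u] by simp

lemma fourier_kern:
  assumes "c > 0"
  shows "fourier (\<lambda>x. of_real (kern c x)) t =
    (\<Prod>i\<in>UNIV. fourier (\<lambda>r. (kprod (of_real c * of_real r))\<^sup>2) (t $ i))"
proof -
  have "\<exists>\<tau>. paley_wiener \<tau> (\<lambda>z. (kprod (of_real c * z))\<^sup>2)"
    using paley_wiener_kern_factor[OF assms, of 0] by auto
  then show ?thesis
    unfolding of_real_kern by (rule fourier_tensor)
qed

text \<open>Some coordinate of \<open>t\<close> has modulus at least \<open>c\<close>, and the
  factor in that coordinate has type \<open>2 * c < 2 * pi * \<bar>t $ i\<bar>\<close>. The slack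
  \<open>pi > 1\<close> allows equality in the hypothesis on \<open>norm t\<close>.\<close>

lemma fourier_kern_eq_0:
  fixes t :: "real ^ 'n::finite"
  assumes c: "c > 0" and t: "real CARD('n) * c \<le> norm t"
  shows "fourier (\<lambda>x. of_real (kern c x)) t = 0"
proof -
  have "\<exists>i. c \<le> \<bar>t $ i\<bar>"
  proof (rule ccontr)
    assume "\<not> ?thesis"
    then have "(\<Sum>i\<in>UNIV. \<bar>t $ i\<bar>) < (\<Sum>i\<in>(UNIV::'n set). c)"
      by (intro sum_strict_mono) (auto simp: not_le)
    with norm_le_l1_cart[of t] t show False by simp
  qed
  then obtain i where i: "c \<le> \<bar>t $ i\<bar>" ..
  have "pi * \<bar>t $ i\<bar> > 1 * c"
    using i c pi_gt3 by (intro mult_less_le_imp_less) auto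
  then have "fourier (\<lambda>r. (kprod (of_real c * of_real r))\<^sup>2) (t $ i) = 0"
    using fourier_paley_wiener_eq_0[OF paley_wiener_kern_factor[OF c, of 0], of "t $ i"] by simp
  then show ?thesis
    unfolding fourier_kern[OF c] by (intro prod_zero) auto
qed

text \<open>Substituting \<open>2 * r\<close> for \<open>r\<close> in each coordinate gives one
  factor 2 per dimension.\<close>

lemma fourier_kern_half:
  assumes c: "c > 0"
  shows "fourier (\<lambda>x::real ^ 'n::finite. of_real (kern (c / 2) x)) 0 =
    2 ^ CARD('n) * fourier (\<lambda>x::real ^ 'n. of_real (kern c x)) 0"
proof -
  have c2: "c / 2 > 0" using c by simp
  have *: "fourier (\<lambda>r. (kprod (of_real (c / 2) * of_real r))\<^sup>2) 0 = 2 * fourier (\<lambda>r. (kprod (of_real c * of_real r))\<^sup>2) (0::real)"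
    using lborel_integral_real_affine[of 2 "\<lambda>r. (kprod (of_real (c / 2) * of_real r))\<^sup>2" 0]
    by (simp add: fourier_def scaleR_conv_of_real)
  show ?thesis
    unfolding fourier_kern[OF c] fourier_kern[OF c2] zero_index *
    by (simp add: power_mult_distrib)
qed

section \<open>Modulated and translated kernels as test functions\<close>

definition wave :: "real ^ 'n \<Rightarrow> real ^ 'n \<Rightarrow> real \<Rightarrow> real ^ 'n::finite \<Rightarrow> complex" where
  "wave l u c x = exp (2 * of_real pi * \<i> * of_real (l \<bullet> x)) * of_real (kern c (x - u))"

lemma wave_0: "wave 0 u c x = of_real (kern c (x - u))"
  by (simp add: wave_def)

lemma schwartz_wave:
  assumes "c > 0"
  shows "schwartz (wave l u c)"
proof -
  define f where "f i z = exp (\<i> * of_real (2 * pi * l $ i) * z) * (kprod (of_real c * (z - of_real (u $ i))))\<^sup>2" for i z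
  have "wave l u c = tensor f"
    unfolding wave_def of_real_kern
    by (auto simp: fun_eq_iff f_def tensor_def prod.distrib inner_vec_def sum_distrib_left exp_sum mult_ac)
  moreover have "\<exists>\<tau>. paley_wiener \<tau> (f i)" for i
    unfolding f_def using paley_wiener_modulate[OF paley_wiener_kern_factor[OF assms]] by blast
  ultimately show ?thesis using schwartz_tensor by metis
qed

text \<open>Modulation by \<open>l\<close> moves the transform to \<open>l\<close>, and translation
  by \<open>u\<close> only adds a phase. The phase is 1 at \<open>t = l\<close>, which later makes
  diagonal terms independent of \<open>u\<close>.\<close>

lemma fourier_wave:
  "fourier (wave l u c) t =
     exp (- 2 * of_real pi * \<i> * of_real ((t - l) \<bullet> u)) * fourier (\<lambda>x. of_real (kern c x)) (t - l)"
proof -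
  have meas: "(\<lambda>x. of_real (kern c (x - u)) * exp (- 2 * of_real pi * \<i> * of_real ((t - l) \<bullet> x))) \<in> borel_measurable borel"
    by (intro borel_measurable_continuous_onI continuous_intros)
  have "fourier (wave l u c) t =
      (LINT x|lborel. of_real (kern c (x - u)) * exp (- 2 * of_real pi * \<i> * of_real ((t - l) \<bullet> x)))"
    unfolding fourier_def wave_def
    by (intro Bochner_Integration.integral_cong)
       (auto simp: inner_diff_left right_diff_distrib algebra_simps simp flip: exp_add)
  also have "\<dots> = (LINT x|distr lborel borel ((+) u). of_real (kern c (x - u)) * exp (- 2 * of_real pi * \<i> * of_real ((t - l) \<bullet> x)))"
    by (simp add: lborel_distr_plus)
  also have "\<dots> = (LINT x|lborel. of_real (kern c x) * exp (- 2 * of_real pi * \<i> * of_real ((t - l) \<bullet> (u + x))))"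
    using meas by (subst integral_distr) auto
  also have "\<dots> = (LINT x|lborel. exp (- 2 * of_real pi * \<i> * of_real ((t - l) \<bullet> u)) *
      (of_real (kern c x) * exp (- 2 * of_real pi * \<i> * of_real ((t - l) \<bullet> x))))"
    by (intro Bochner_Integration.integral_cong)
       (auto simp: inner_add_right algebra_simps simp flip: exp_add)
  finally show ?thesis
    by (simp add: fourier_def)
qed

section \<open>Purely atomic measures\<close>

text \<open>An enumeration exhausts \<open>A\<close> by increasing finite sets, and monotone
  convergence applies. The supremum over finite sets matches the one in
  \<open>total_variation\<close>.\<close>

lemma nn_integral_count_space_SUP_finite:
  fixes f :: "'a \<Rightarrow> ennreal"
  assumes "countable A"
  shows "(\<integral>\<^sup>+ a. f a \<partial>count_space A) = (SUP F\<in>{F. finite F \<and> F \<subseteq> A}. sum f F)"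
proof (rule antisym)
  define F where "F n = {a \<in> A. to_nat_on A a \<le> n}" for n
  have fin: "finite (F n)" for n
    unfolding F_def using assms
    by (intro finite_imageD[where f = "to_nat_on A"] finite_subset[OF _ finite_atMost[of n]])
       (auto intro: inj_on_subset inj_on_to_nat_on)
  have "f a = (SUP n. f a * indicator (F n) a)" if "a \<in> A" for a
  proof (rule antisym)
    have "f a = f a * indicator (F (to_nat_on A a)) a"
      using that by (simp add: F_def)
    also have "\<dots> \<le> (SUP n. f a * indicator (F n) a)"
      by (rule SUP_upper) simp
    finally show "f a \<le> (SUP n. f a * indicator (F n) a)" .
  qed (auto intro!: SUP_least simp: indicator_def)
  then have "(\<integral>\<^sup>+ a. f a \<partial>count_space A) = (\<integral>\<^sup>+ a. (SUP n. f a * indicator (F n) a) \<partial>count_space A)"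
    by (intro nn_integral_cong) simp
  also have "\<dots> = (SUP n. \<integral>\<^sup>+ a. f a * indicator (F n) a \<partial>count_space A)"
    by (intro nn_integral_monotone_convergence_SUP)
       (auto simp: incseq_def le_fun_def F_def indicator_def)
  also have "\<dots> = (SUP n. sum f (F n))"
  proof (intro SUP_cong refl)
    fix n
    have "(\<integral>\<^sup>+ a. f a * indicator (F n) a \<partial>count_space A) = (\<Sum>a\<in>F n. f a * indicator (F n) a)"
      using fin by (intro nn_integral_count_space') (auto simp: F_def)
    then show "(\<integral>\<^sup>+ a. f a * indicator (F n) a \<partial>count_space A) = sum f (F n)" by simp
  qed
  also have "\<dots> \<le> (SUP F\<in>{F. finite F \<and> F \<subseteq> A}. sum f F)"
    using fin by (intro SUP_mono) (auto simp: F_def)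
  finally show "(\<integral>\<^sup>+ a. f a \<partial>count_space A) \<le> (SUP F\<in>{F. finite F \<and> F \<subseteq> A}. sum f F)" .
  show "(SUP F\<in>{F. finite F \<and> F \<subseteq> A}. sum f F) \<le> (\<integral>\<^sup>+ a. f a \<partial>count_space A)"
  proof (rule SUP_least)
    fix F assume "F \<in> {F. finite F \<and> F \<subseteq> A}"
    then have "sum f F = (\<integral>\<^sup>+ a. f a * indicator F a \<partial>count_space A)"
      by (subst nn_integral_count_space'[of F]) auto
    also have "\<dots> \<le> (\<integral>\<^sup>+ a. f a \<partial>count_space A)"
      by (intro nn_integral_mono) (auto simp: indicator_def)
    finally show "sum f F \<le> (\<integral>\<^sup>+ a. f a \<partial>count_space A)" .
  qed
qed

section \<open>Total variation, polar density and integrals of a sum of atoms\<close>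

context
  fixes \<mu> :: "'a::euclidean_space set \<Rightarrow> complex" and A :: "'a set"
  assumes atoms: "sum_of_atoms \<mu> A" and countable_A: "countable A"
begin

text \<open>For complex families unconditional summability is absolute summability, so
  \<open>has_sum\<close> can be replaced by a Bochner integral over
  \<open>count_space A\<close>.\<close>

lemma atoms_bounded_set:
  assumes "E \<in> sets borel" "bounded E"
  shows "integrable (count_space A) (\<lambda>a. \<mu> {a} * indicator E a)"
    and "\<mu> E = (LINT a|count_space A. \<mu> {a} * indicator E a)"
proof -
  have hs: "((\<lambda>a. \<mu> {a} * indicator E a) has_sum \<mu> E) A"
    using atoms assms unfolding sum_of_atoms_def by blast
  then have "(\<lambda>a. \<mu> {a} * indicator E a) summable_on A"
    by (rule has_sum_imp_summable)
  then have *: "Infinite_Set_Sum.abs_summable_on (\<lambda>a. \<mu> {a} * indicator E a) A"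
    unfolding summable_on_iff_abs_summable_on_complex abs_summable_equivalent .
  then show "integrable (count_space A) (\<lambda>a. \<mu> {a} * indicator E a)"
    by (simp add: abs_summable_on_def)
  show "\<mu> E = (LINT a|count_space A. \<mu> {a} * indicator E a)"
    using infsumI[OF hs] infsetsum_infsum[OF *] by (simp add: infsetsum_def)
qed

lemma atom_eq_0:
  assumes "a \<notin> A"
  shows "\<mu> {a} = 0"
proof -
  have "\<mu> {a} = (LINT b|count_space A. \<mu> {b} * indicator {a} b)"
    by (rule atoms_bounded_set(2)) auto
  also have "\<dots> = (LINT b|count_space A. 0)"
    using assms by (intro Bochner_Integration.integral_cong) (auto simp: indicator_def)
  finally show ?thesis by simp
qed

text \<open>Upper bound: the triangle inequality on each piece of a finite disjoint family inside
  \<open>E\<close>. Lower bound: families of singletons taken from finite subsets of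
  \<open>A\<close>.\<close>

lemma total_variation_atoms:
  "total_variation \<mu> E = (\<integral>\<^sup>+ a. ennreal (norm (\<mu> {a})) * indicator E a \<partial>count_space A)"
proof (rule antisym)
  show "total_variation \<mu> E \<le> (\<integral>\<^sup>+ a. ennreal (norm (\<mu> {a})) * indicator E a \<partial>count_space A)"
    unfolding total_variation_def
  proof (rule SUP_least)
    fix P assume "P \<in> {P. finite P \<and> disjoint P \<and> (\<forall>B\<in>P. B \<in> sets borel \<and> bounded B \<and> B \<subseteq> E)}"
    then have P: "finite P" "disjoint P" "\<And>B. B \<in> P \<Longrightarrow> B \<in> sets borel \<and> bounded B \<and> B \<subseteq> E"
      by auto
    have "(\<Sum>B\<in>P. ennreal (norm (\<mu> B))) \<le>
        (\<Sum>B\<in>P. \<integral>\<^sup>+ a. ennreal (norm (\<mu> {a})) * indicator B a \<partial>count_space A)"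
    proof (rule sum_mono)
      fix B assume "B \<in> P"
      then have B: "B \<in> sets borel" "bounded B" using P by auto
      have "ennreal (norm (\<mu> B)) \<le> (\<integral>\<^sup>+ a. ennreal (norm (\<mu> {a} * indicator B a)) \<partial>count_space A)"
        unfolding atoms_bounded_set(2)[OF B]
        by (rule integral_norm_bound_ennreal[OF atoms_bounded_set(1)[OF B]])
      also have "\<dots> = (\<integral>\<^sup>+ a. ennreal (norm (\<mu> {a})) * indicator B a \<partial>count_space A)"
        by (intro nn_integral_cong) (auto simp: indicator_def)
      finally show "ennreal (norm (\<mu> B)) \<le> (\<integral>\<^sup>+ a. ennreal (norm (\<mu> {a})) * indicator B a \<partial>count_space A)" .
    qed
    also have "\<dots> = (\<integral>\<^sup>+ a. ennreal (norm (\<mu> {a})) * (\<Sum>B\<in>P. indicator B a) \<partial>count_space A)"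
      by (subst nn_integral_sum[symmetric]) (simp_all add: sum_distrib_left)
    also have "\<dots> \<le> (\<integral>\<^sup>+ a. ennreal (norm (\<mu> {a})) * indicator E a \<partial>count_space A)"
    proof (intro nn_integral_mono mult_left_mono)
      fix a
      have "(\<Sum>B\<in>P. indicator B a) = (indicator (\<Union>B\<in>P. B) a :: ennreal)"
        using P(1,2) by (intro indicator_UN_disjoint[symmetric]) (auto simp: disjoint_family_on_def disjoint_def)
      also have "\<dots> \<le> indicator E a"
        using P(3) by (auto simp: indicator_def)
      finally show "(\<Sum>B\<in>P. indicator B a) \<le> (indicator E a :: ennreal)" .
    qed simp
    finally show "(\<Sum>B\<in>P. ennreal (norm (\<mu> B))) \<le> (\<integral>\<^sup>+ a. ennreal (norm (\<mu> {a})) * indicator E a \<partial>count_space A)" .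
  qed
  show "(\<integral>\<^sup>+ a. ennreal (norm (\<mu> {a})) * indicator E a \<partial>count_space A) \<le> total_variation \<mu> E"
    unfolding nn_integral_count_space_SUP_finite[OF countable_A]
  proof (rule SUP_least)
    fix F assume "F \<in> {F. finite F \<and> F \<subseteq> A}"
    then have F: "finite F" by simp
    have "(\<Sum>a\<in>F. ennreal (norm (\<mu> {a})) * indicator E a) = (\<Sum>a\<in>F \<inter> E. ennreal (norm (\<mu> {a})))"
      using F by (simp add: sum.inter_restrict indicator_def if_distrib cong: if_cong)
    also have "\<dots> = (\<Sum>B\<in>(\<lambda>a. {a}) ` (F \<inter> E). ennreal (norm (\<mu> B)))"
      by (subst sum.reindex) (auto simp: inj_on_def)
    also have "\<dots> \<le> total_variation \<mu> E"
      unfolding total_variation_def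
      using F by (intro SUP_upper) (auto simp: disjoint_def)
    finally show "(\<Sum>a\<in>F. ennreal (norm (\<mu> {a})) * indicator E a) \<le> total_variation \<mu> E" .
  qed
qed

text \<open>\<open>measure_of\<close> depends only on the values on the sigma-algebra, so agreement
  with a genuine measure suffices and countable additivity of \<open>total_variation\<close> comes
  for free. The \<open>distr\<close> along the identity passes from all subsets of \<open>A\<close>
  to the Borel sets.\<close>

lemma variation_measure_atoms:
  "variation_measure \<mu> = distr (density (count_space A) (\<lambda>a. ennreal (norm (\<mu> {a})))) borel (\<lambda>a. a)"
    (is "_ = ?N")
proof -
  have "measure_of UNIV (sets borel) (total_variation \<mu>) = measure_of UNIV (sets borel) (emeasure ?N)"
  proof (rule measure_of_eq)
    fix E :: "'a set" assume "E \<in> sigma_sets UNIV (sets borel)"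
    then have E: "E \<in> sets borel"
      using sets.sigma_sets_eq[of "borel :: 'a measure"] by simp
    have "emeasure ?N E = (\<integral>\<^sup>+ a. ennreal (norm (\<mu> {a})) * indicator ((\<lambda>a. a) -` E \<inter> A) a \<partial>count_space A)"
      using E by (simp add: emeasure_distr emeasure_density)
    also have "\<dots> = total_variation \<mu> E"
      unfolding total_variation_atoms by (intro nn_integral_cong) (auto simp: indicator_def)
    finally show "total_variation \<mu> E = emeasure ?N E" ..
  qed simp
  also have "\<dots> = ?N"
    using measure_of_of_measure[of ?N] by simp
  finally show ?thesis
    unfolding variation_measure_def .
qed

lemma integral_variation_measure:
  fixes f :: "'a \<Rightarrow> complex"
  assumes "f \<in> borel_measurable borel"
  shows "(LINT x|variation_measure \<mu>. f x) = (LINT a|count_space A. of_real (norm (\<mu> {a})) * f a)"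
  unfolding variation_measure_atoms using assms
  by (simp add: integral_distr integral_density scaleR_conv_of_real)

text \<open>The choice operator needs a witness: \<open>sgn (\<mu> {a})\<close> at the atoms and 1
  elsewhere. Conversely, testing on singletons determines any admissible density at every atom of
  nonzero mass.\<close>

lemma polar_density_atoms:
  shows "polar_density \<mu> \<in> borel_measurable borel"
    and "a \<in> A \<Longrightarrow> of_real (norm (\<mu> {a})) * polar_density \<mu> a = \<mu> {a}"
proof -
  define P where "P h \<longleftrightarrow> h \<in> borel_measurable borel \<and> (\<forall>x. norm (h x) = 1) \<and>
    (\<forall>E\<in>sets borel. bounded E \<longrightarrow> \<mu> E = (LINT x:E|variation_measure \<mu>. h x))" for h :: "'a \<Rightarrow> complex"
  have integral: "(LINT x:E|variation_measure \<mu>. h x) =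
      (LINT a|count_space A. of_real (norm (\<mu> {a})) * h a * indicator E a)"
    if "h \<in> borel_measurable borel" "E \<in> sets borel" for h :: "'a \<Rightarrow> complex" and E
    unfolding set_lebesgue_integral_def using that
    by (subst integral_variation_measure)
       (auto intro!: Bochner_Integration.integral_cong simp: indicator_def)
  define h where "h a = (if a \<in> A \<and> \<mu> {a} \<noteq> 0 then sgn (\<mu> {a}) else 1)" for a
  have "P h"
    unfolding P_def
  proof (intro conjI ballI allI impI)
    show meas: "h \<in> borel_measurable borel"
      \<comment> \<open>The witness differs from the constant 1 only on the countable set
        \<open>A\<close>.\<close>
      by (rule measurable_discrete_difference[where f = "\<lambda>_. 1", OF _ countable_A]) (auto simp: h_def)
    show "norm (h x) = 1" for x
      by (simp add: h_def norm_sgn)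
    fix E :: "'a set" assume E: "E \<in> sets borel" "bounded E"
    have "of_real (norm z) * sgn z = z" for z :: complex
      by (cases "z = 0") (simp_all add: sgn_div_norm scaleR_conv_of_real)
    then show "\<mu> E = (LINT x:E|variation_measure \<mu>. h x)"
      unfolding integral[OF meas E(1)] atoms_bounded_set(2)[OF E]
      by (intro Bochner_Integration.integral_cong) (auto simp: h_def)
  qed
  then have "P (SOME h. P h)" by (rule someI[of P])
  then have *: "P (polar_density \<mu>)"
    unfolding polar_density_def P_def .
  then show "polar_density \<mu> \<in> borel_measurable borel"
    by (simp add: P_def)
  assume a: "a \<in> A"
  have "\<mu> {a} = (LINT b|count_space A. of_real (norm (\<mu> {b})) * polar_density \<mu> b * indicator {a} b)"
    using * integral[of "polar_density \<mu>" "{a}"] unfolding P_def by auto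
  also have "\<dots> = (\<Sum>b | b \<in> A \<and> of_real (norm (\<mu> {b})) * polar_density \<mu> b * indicator {a} b \<noteq> 0.
      of_real (norm (\<mu> {b})) * polar_density \<mu> b * indicator {a} b)"
    by (rule lebesgue_integral_count_space_finite_support)
       (rule finite_subset[of _ "{a}"], auto simp: indicator_def)
  also have "\<dots> = (\<Sum>b\<in>{a}. of_real (norm (\<mu> {b})) * polar_density \<mu> b * indicator {a} b)"
    using a by (intro sum.mono_neutral_left) (auto simp: indicator_def)
  finally show "of_real (norm (\<mu> {a})) * polar_density \<mu> a = \<mu> {a}" by simp
qed

lemma cm_integral_atoms:
  assumes "f \<in> borel_measurable borel"
  shows "cm_integral \<mu> f = (LINT a|count_space A. \<mu> {a} * f a)"
proof -
  have "cm_integral \<mu> f = (LINT a|count_space A. of_real (norm (\<mu> {a})) * (f a * polar_density \<mu> a))"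
    unfolding cm_integral_def
    using assms polar_density_atoms(1) by (intro integral_variation_measure) auto
  also have "\<dots> = (LINT a|count_space A. \<mu> {a} * f a)"
    using polar_density_atoms(2)
    by (intro Bochner_Integration.integral_cong) (auto simp: mult_ac)
  finally show ?thesis .
qed

text \<open>Dominate \<open>norm (f a)\<close> by a sum of weights \<open>w k\<close> over growing
  balls. The weights decay with exponent \<open>N + 2\<close> while the variation of the balls grows
  with exponent \<open>N\<close>, which leaves the summable \<open>1 / (1 + k) ^ 2\<close>.\<close>

lemma integrable_atoms_rapid_decay:
  fixes f :: "'a \<Rightarrow> complex"
  assumes slow: "slowly_increasing \<mu>"
    and f: "\<And>k::nat. bounded (range (\<lambda>x. norm x ^ k * norm (f x)))"
  shows "integrable (count_space A) (\<lambda>a. \<mu> {a} * f a)"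
proof -
  obtain N C R1 where tv: "\<And>R. R \<ge> R1 \<Longrightarrow> total_variation \<mu> (ball 0 R) \<le> ennreal (C * R ^ N)"
    using slow unfolding slowly_increasing_def eventually_at_top_linorder by blast
  \<comment> \<open>Beyond \<open>R1\<close> the growth bound holds; being at least 1 gives both
    \<open>R0 + k \<le> R0 * (1 + k)\<close> and the comparison of \<open>k\<close> with
    \<open>norm a\<close> below.\<close>
  define R0 where "R0 = max 1 R1"
  have R0: "R0 \<ge> 1" by (simp add: R0_def)
  obtain D where D: "\<And>x. (1 + norm x) ^ (N + 2) * norm (f x) \<le> D"
  proof -
    have "\<exists>B. \<forall>x. norm x ^ k * norm (f x) \<le> B" for k
    proof -
      obtain B where "\<forall>y\<in>range (\<lambda>x. norm x ^ k * norm (f x)). norm y \<le> B"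
        using f[of k] unfolding bounded_iff by blast
      then show ?thesis by (intro exI[of _ B]) simp
    qed
    then obtain B where B: "\<And>k x. norm x ^ k * norm (f x) \<le> B k" by metis
    define D0 D1 where "D0 = B 0" and "D1 = B (N + 2)"
    note D0 = B[of _ 0, folded D0_def] and D1 = B[of _ "N + 2", folded D1_def]
    have "(1 + norm x) ^ (N + 2) * norm (f x) \<le> 2 ^ (N + 2) * (D0 + D1)" for x
    proof -
      have "(1 + norm x) ^ (N + 2) \<le> (2 * max 1 (norm x)) ^ (N + 2)"
        by (intro power_mono) auto
      also have "\<dots> \<le> 2 ^ (N + 2) * (1 + norm x ^ (N + 2))"
        unfolding power_mult_distrib by (auto simp: max_def)
      finally have "(1 + norm x) ^ (N + 2) * norm (f x) \<le> 2 ^ (N + 2) * (1 + norm x ^ (N + 2)) * norm (f x)"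
        by (rule mult_right_mono) simp
      also have "\<dots> = 2 ^ (N + 2) * (norm x ^ 0 * norm (f x) + norm x ^ (N + 2) * norm (f x))"
        by (simp add: algebra_simps)
      also have "\<dots> \<le> 2 ^ (N + 2) * (D0 + D1)"
        by (intro mult_left_mono add_mono D0 D1) auto
      finally show ?thesis .
    qed
    then show ?thesis by (rule that)
  qed
  have D0: "0 \<le> D" using D[of 0] norm_ge_zero[of "f 0"] by (simp del: norm_ge_zero)
  define w where "w k = D / (1 + real k) ^ (N + 2)" for k
  have w0: "0 \<le> w k" for k using D0 by (simp add: w_def)
  have pointwise: "ennreal (norm (f a)) \<le> (\<Sum>k. ennreal (w k) * indicator (ball 0 (R0 + real k)) a)" for a
  proof -
    have ex: "\<exists>k. norm a < R0 + real k"
      using reals_Archimedean2[of "norm a - R0"] by (auto simp: algebra_simps)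
    define k where "k = (LEAST k. norm a < R0 + real k)"
    have k: "norm a < R0 + real k" unfolding k_def using ex by (rule LeastI_ex)
    \<comment> \<open>Minimality of \<open>k\<close> puts \<open>a\<close> outside the previous
      ball, so \<open>norm a \<ge> R0 + (k - 1) \<ge> k\<close> when \<open>k > 0\<close>.\<close>
    have ge: "1 + real k \<le> 1 + norm a"
    proof (cases k)
      case (Suc j)
      then have "\<not> norm a < R0 + real j"
        unfolding k_def by (metis lessI not_less_Least)
      then show ?thesis using Suc R0 by simp
    qed simp
    have "(1 + real k) ^ (N + 2) * norm (f a) \<le> (1 + norm a) ^ (N + 2) * norm (f a)"
      using ge by (intro mult_right_mono power_mono) auto
    also have "\<dots> \<le> D" by (rule D)
    finally have "norm (f a) \<le> w k"
      by (simp add: w_def pos_le_divide_eq mult.commute)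
    moreover define g where "g k = ennreal (w k) * indicator (ball 0 (R0 + real k)) a" for k
    ultimately have "ennreal (norm (f a)) \<le> g k"
      using k w0 by (simp add: ennreal_leI)
    also have "\<dots> = sum g {k}" by simp
    also have "\<dots> \<le> suminf g"
      by (intro sum_le_suminf) auto
    finally show ?thesis by (simp add: g_def[abs_def])
  qed
  have "(\<integral>\<^sup>+ a. ennreal (norm (\<mu> {a} * f a)) \<partial>count_space A) \<le>
      (\<integral>\<^sup>+ a. (\<Sum>k. ennreal (w k) * (ennreal (norm (\<mu> {a})) * indicator (ball 0 (R0 + real k)) a)) \<partial>count_space A)"
  proof (rule nn_integral_mono)
    fix a
    have "ennreal (norm (\<mu> {a} * f a)) = ennreal (norm (\<mu> {a})) * ennreal (norm (f a))"
      by (simp add: norm_mult ennreal_mult)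
    also have "\<dots> \<le> ennreal (norm (\<mu> {a})) * (\<Sum>k. ennreal (w k) * indicator (ball 0 (R0 + real k)) a)"
      by (intro mult_left_mono pointwise) simp
    also have "\<dots> = (\<Sum>k. ennreal (w k) * (ennreal (norm (\<mu> {a})) * indicator (ball 0 (R0 + real k)) a))"
      by (subst ennreal_suminf_cmult[symmetric]) (simp add: mult_ac)
    finally show "ennreal (norm (\<mu> {a} * f a)) \<le>
      (\<Sum>k. ennreal (w k) * (ennreal (norm (\<mu> {a})) * indicator (ball 0 (R0 + real k)) a))" .
  qed
  also have "\<dots> = (\<Sum>k. ennreal (w k) * total_variation \<mu> (ball 0 (R0 + real k)))"
    by (subst nn_integral_suminf) (simp_all add: nn_integral_cmult total_variation_atoms)
  also have "\<dots> \<le> (\<Sum>k. ennreal (D * (\<bar>C\<bar> * R0 ^ N) * (1 / (1 + real k) ^ 2)))"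
  proof (rule suminf_le)
    fix k
    have "C * (R0 + real k) ^ N \<le> \<bar>C\<bar> * (R0 * (1 + real k)) ^ N"
    proof (intro mult_mono power_mono)
      show "R0 + real k \<le> R0 * (1 + real k)"
        using mult_right_mono[OF R0, of "real k"] by (simp add: algebra_simps)
    qed (use R0 in auto)
    then have "w k * (C * (R0 + real k) ^ N) \<le> w k * (\<bar>C\<bar> * (R0 * (1 + real k)) ^ N)"
      by (rule mult_left_mono) (rule w0)
    also have "\<dots> = D * (\<bar>C\<bar> * R0 ^ N) * (1 / (1 + real k) ^ 2)"
      by (simp add: w_def power_mult_distrib power_add power2_eq_square)
    finally have le: "w k * (C * (R0 + real k) ^ N) \<le> D * (\<bar>C\<bar> * R0 ^ N) * (1 / (1 + real k) ^ 2)" .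
    have "ennreal (w k) * total_variation \<mu> (ball 0 (R0 + real k)) \<le> ennreal (w k) * ennreal (C * (R0 + real k) ^ N)"
      by (intro mult_left_mono tv) (auto simp: R0_def)
    also have "\<dots> = ennreal (w k * (C * (R0 + real k) ^ N))"
      using w0 by (simp add: ennreal_mult')
    also have "\<dots> \<le> ennreal (D * (\<bar>C\<bar> * R0 ^ N) * (1 / (1 + real k) ^ 2))"
      by (rule ennreal_leI[OF le])
    finally show "ennreal (w k) * total_variation \<mu> (ball 0 (R0 + real k)) \<le> ennreal (D * (\<bar>C\<bar> * R0 ^ N) * (1 / (1 + real k) ^ 2))" .
  qed auto
  also have "\<dots> < \<infinity>"
  proof -
    have "summable (\<lambda>k. 1 / (1 + real k) ^ 2)"
      using inverse_power_summable[of 2, where 'a = real]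
        summable_Suc_iff[of "\<lambda>k. inverse (real k ^ 2)"]
      by (simp add: inverse_eq_divide)
    then have "summable (\<lambda>k. D * (\<bar>C\<bar> * R0 ^ N) * (1 / (1 + real k) ^ 2))"
      by (rule summable_mult)
    then show ?thesis
      using D0 R0 by (subst suminf_ennreal2) auto
  qed
  finally show ?thesis
    by (intro integrableI_bounded) auto
qed

end

section \<open>Correlations of the spectrum\<close>

lemma uniform_discrete_finite_bounded:
  fixes A :: "'a::heine_borel set"
  assumes "uniform_discrete A" "bounded B"
  shows "finite (A \<inter> B)"
proof -
  have "uniform_discrete (A \<inter> B)"
    by (rule uniform_discrete_subset[OF assms(1)]) simp
  moreover have "bounded (A \<inter> B)"
    using assms(2) by (rule bounded_subset) simp
  ultimately show ?thesis
    using uniform_discrete_finite_iff by blast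
qed

lemma uniform_discrete_countable:
  fixes A :: "'a::euclidean_space set"
  assumes "uniform_discrete A"
  shows "countable A"
proof -
  have "countable (\<Union>n::nat. A \<inter> cball 0 (real n))"
    by (intro countable_UN) (auto intro!: countable_finite uniform_discrete_finite_bounded[OF assms])
  moreover have "A \<subseteq> (\<Union>n::nat. A \<inter> cball 0 (real n))"
    using real_arch_simple by auto
  ultimately show ?thesis
    by (rule countable_subset[rotated])
qed

lemma measurable_fourier:
  fixes \<phi> :: "'a::euclidean_space \<Rightarrow> complex"
  assumes [measurable]: "\<phi> \<in> borel_measurable borel"
  shows "fourier \<phi> \<in> borel_measurable borel"
  unfolding fourier_def[abs_def] by measurable

lemma integral_count_space_eq_sum:
  fixes f :: "'a \<Rightarrow> 'b::{banach,second_countable_topology}"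
  assumes "finite F" "F \<subseteq> A" "\<And>a. a \<in> A - F \<Longrightarrow> f a = 0"
  shows "(LINT a|count_space A. f a) = sum f F"
proof -
  have "(LINT a|count_space A. f a) = (\<Sum>a | a \<in> A \<and> f a \<noteq> 0. f a)"
    by (rule lebesgue_integral_count_space_finite_support) (rule finite_subset[OF _ assms(1)], use assms in auto)
  also have "\<dots> = sum f F"
    using assms by (intro sum.mono_neutral_left) auto
  finally show ?thesis .
qed

text \<open>Dominated convergence, with the integrand at scale \<open>c\<close> as majorant because
  the kernels decrease in \<open>k\<close>. If \<open>u\<close> lies outside \<open>S\<close> the
  limiting sum is empty, and the assumption \<open>b u = 0\<close> keeps the formula true.\<close>

lemma kern_integral_LIMSEQ:
  fixes b :: "real ^ 'n::finite \<Rightarrow> 'b::{banach,second_countable_topology}"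
  assumes c: "c > 0" and int: "integrable (count_space S) (\<lambda>s. kern c (s - u) *\<^sub>R b s)"
    and b0: "u \<notin> S \<Longrightarrow> b u = 0"
  shows "(\<lambda>k. LINT s|count_space S. kern (2 ^ k * c) (s - u) *\<^sub>R b s) \<longlonglongrightarrow> b u"
proof -
  have "(\<lambda>k. LINT s|count_space S. kern (2 ^ k * c) (s - u) *\<^sub>R b s) \<longlonglongrightarrow>
      (LINT s|count_space S. (if s - u = 0 then 1 else 0) *\<^sub>R b s)"
  proof (rule integral_dominated_convergence)
    show "integrable (count_space S) (\<lambda>s. norm (kern c (s - u) *\<^sub>R b s))"
      using int by (rule integrable_norm)
    show "AE s in count_space S. norm (kern (2 ^ k * c) (s - u) *\<^sub>R b s) \<le> norm (kern c (s - u) *\<^sub>R b s)" for k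
      by (intro AE_I2) (simp add: kern_nonneg kern_power_antimono mult_right_mono)
    show "AE s in count_space S. (\<lambda>k. kern (2 ^ k * c) (s - u) *\<^sub>R b s) \<longlonglongrightarrow> (if s - u = 0 then 1 else 0) *\<^sub>R b s"
      by (intro AE_I2 tendsto_scaleR kern_LIMSEQ[OF c] tendsto_const)
  qed auto
  also have "(LINT s|count_space S. (if s - u = 0 then 1 else 0) *\<^sub>R b s) = (\<Sum>s\<in>S \<inter> {u}. (if s - u = 0 then 1 else 0) *\<^sub>R b s)"
    by (rule integral_count_space_eq_sum) auto
  also have "\<dots> = b u"
    using b0 by (cases "u \<in> S") auto
  finally show ?thesis .
qed

section \<open>Poisson summation for a separated support and an atomic transform\<close>

locale fourier_pair =
  fixes \<mu> \<nu> :: "(real ^ 'n::finite) set \<Rightarrow> complex" and \<Lambda> S :: "(real ^ 'n) set" and \<delta> :: real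
  assumes positive_definite: "positive_definite \<mu>"
    and \<delta>_pos: "\<delta> > 0"
    and separated: "\<And>x y. x \<in> \<Lambda> \<Longrightarrow> y \<in> \<Lambda> \<Longrightarrow> dist x y < \<delta> \<Longrightarrow> x = y"
    and atoms_\<mu>: "sum_of_atoms \<mu> \<Lambda>"
    and slow_\<nu>: "slowly_increasing \<nu>"
    and fourier_\<nu>: "fourier_transform_is \<mu> \<nu>"
    and countable_S: "countable S"
    and atoms_\<nu>: "sum_of_atoms \<nu> S"
    and \<nu>_nonzero: "\<And>s. s \<in> S \<Longrightarrow> \<nu> {s} \<noteq> 0"
begin

lemma uniform_discrete_\<Lambda>: "uniform_discrete \<Lambda>"
  unfolding uniform_discrete_def using \<delta>_pos separated by blast

text \<open>Chosen so that the transform of \<open>kern scale\<close> vanishes at distance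
  \<open>\<delta>\<close> or more from the origin.\<close>

definition scale where "scale = \<delta> / real CARD('n)"

lemma scale_pos: "scale > 0"
  by (simp add: scale_def \<delta>_pos)

lemma CARD_scale: "real CARD('n) * scale = \<delta>"
  by (simp add: scale_def)

definition kernhat :: "real \<Rightarrow> real ^ 'n \<Rightarrow> complex" where
  "kernhat c t = fourier (\<lambda>x. of_real (kern c x)) t"

lemma kernhat_eq_0: "c > 0 \<Longrightarrow> real CARD('n) * c \<le> norm t \<Longrightarrow> kernhat c t = 0"
  unfolding kernhat_def by (rule fourier_kern_eq_0)

lemma kernhat_half: "kernhat (scale / 2) 0 = 2 ^ CARD('n) * kernhat scale 0"
  unfolding kernhat_def by (rule fourier_kern_half[OF scale_pos])

lemma fourier_wave': "fourier (wave l u c) t =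
    exp (- 2 * of_real pi * \<i> * of_real ((t - l) \<bullet> u)) * kernhat c (t - l)"
  by (simp add: fourier_wave kernhat_def)

lemma measurable_wave: "wave l u c \<in> borel_measurable borel"
  unfolding wave_def by (intro borel_measurable_continuous_onI continuous_intros)

lemma integrable_wave:
  assumes "c > 0"
  shows "integrable (count_space S) (\<lambda>s. \<nu> {s} * wave l u c s)"
proof (rule integrable_atoms_rapid_decay[OF atoms_\<nu> countable_S slow_\<nu>])
  fix k
  show "bounded (range (\<lambda>x. norm x ^ k * norm (wave l u c x)))"
    using schwartz_wave[OF assms, of l u] unfolding schwartz_def by (metis fold_simps(1))
qed

lemma fourier_distribution_wave:
  assumes "c > 0"
  shows "fourier_distribution \<mu> (wave l u c) = (LINT s|count_space S. \<nu> {s} * wave l u c s)"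
  using fourier_\<nu> schwartz_wave[OF assms, of l u]
    cm_integral_atoms[OF atoms_\<nu> countable_S measurable_wave[of l u c]]
  unfolding fourier_transform_is_def by simp

text \<open>The transform relation is tested on a wave. On the side of \<open>\<Lambda>\<close> only
  points near \<open>l\<close> contribute, by the support of \<open>kernhat c\<close>, and uniform
  discreteness makes them finitely many.\<close>

lemma poisson_wave:
  assumes c: "c > 0"
  shows "(LINT s|count_space S. \<nu> {s} * wave l u c s) =
    (\<Sum>x\<in>\<Lambda> \<inter> ball l (real CARD('n) * c).
      \<mu> {x} * (exp (- 2 * of_real pi * \<i> * of_real ((x - l) \<bullet> u)) * kernhat c (x - l)))"
proof -
  have "(LINT s|count_space S. \<nu> {s} * wave l u c s) = (LINT x|count_space \<Lambda>. \<mu> {x} * fourier (wave l u c) x)"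
    unfolding fourier_distribution_wave[OF c, symmetric] fourier_distribution_def
    by (intro cm_integral_atoms[OF atoms_\<mu> uniform_discrete_countable[OF uniform_discrete_\<Lambda>]]
        measurable_fourier measurable_wave)
  also have "\<dots> = (\<Sum>x\<in>\<Lambda> \<inter> ball l (real CARD('n) * c). \<mu> {x} * fourier (wave l u c) x)"
    using kernhat_eq_0[OF c]
    by (intro integral_count_space_eq_sum uniform_discrete_finite_bounded[OF uniform_discrete_\<Lambda>])
       (auto simp: fourier_wave' dist_norm norm_minus_commute)
  finally show ?thesis by (simp add: fourier_wave')
qed

text \<open>The atom at \<open>u\<close> is a limit of pairings of \<open>\<nu>\<close> with
  nonnegative kernels shrinking to \<open>u\<close>; these are nonnegative by positive-definiteness
  of \<open>\<mu>\<close>, and the nonnegative reals are closed.\<close>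

lemma \<nu>_nonneg: "\<nu> {u} \<in> \<real>\<^sub>\<ge>\<^sub>0"
proof (rule closed_sequentially[OF closed_nonneg_Reals_complex])
  have int: "integrable (count_space S) (\<lambda>s. kern scale (s - u) *\<^sub>R \<nu> {s})"
    using integrable_wave[OF scale_pos, of 0 u] by (simp add: wave_0 scaleR_conv_of_real mult.commute)
  show "(\<lambda>k. LINT s|count_space S. kern (2 ^ k * scale) (s - u) *\<^sub>R \<nu> {s}) \<longlonglongrightarrow> \<nu> {u}"
    using atom_eq_0[OF atoms_\<nu> countable_S] by (intro kern_integral_LIMSEQ[OF scale_pos int])
  fix k
  have c: "2 ^ k * scale > 0" using scale_pos by simp
  have "\<forall>x. wave 0 u (2 ^ k * scale) x \<in> \<real>\<^sub>\<ge>\<^sub>0"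
    by (simp add: wave_0 kern_nonneg)
  then have "fourier_distribution \<mu> (wave 0 u (2 ^ k * scale)) \<in> \<real>\<^sub>\<ge>\<^sub>0"
    using positive_definite schwartz_wave[OF c] unfolding positive_definite_def by blast
  then show "(LINT s|count_space S. kern (2 ^ k * scale) (s - u) *\<^sub>R \<nu> {s}) \<in> \<real>\<^sub>\<ge>\<^sub>0"
    unfolding fourier_distribution_wave[OF c] by (simp add: wave_0 scaleR_conv_of_real mult.commute)
qed

definition mass :: "real ^ 'n \<Rightarrow> real" where
  "mass s = Re (\<nu> {s})"

lemma of_real_mass: "of_real (mass s) = \<nu> {s}"
  using \<nu>_nonneg[of s] by (auto simp: mass_def elim: nonneg_Reals_cases)

lemma mass_nonneg: "0 \<le> mass s"
  using \<nu>_nonneg[of s] by (auto simp: mass_def elim: nonneg_Reals_cases)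

lemma mass_pos_iff: "mass s > 0 \<longleftrightarrow> s \<in> S"
proof -
  have "mass s \<noteq> 0 \<longleftrightarrow> \<nu> {s} \<noteq> 0"
    using of_real_mass[of s] by (metis of_real_eq_0_iff)
  then show ?thesis
    using \<nu>_nonzero atom_eq_0[OF atoms_\<nu> countable_S, of s] mass_nonneg[of s] by (cases "s \<in> S") auto
qed

lemma integrable_mass_kern:
  assumes "c > 0"
  shows "integrable (count_space S) (\<lambda>s. mass s * kern c (s - u))"
proof -
  have "integrable (count_space S) (\<lambda>s. complex_of_real (mass s * kern c (s - u)))"
    using integrable_wave[OF assms, of 0 u] by (simp add: wave_0 of_real_mass)
  then show ?thesis by (simp only: complex_of_real_integrable_eq)
qed

section \<open>Approximation of the masses by trigonometric polynomials\<close>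

definition smoothed_mass :: "nat \<Rightarrow> real ^ 'n \<Rightarrow> real" where
  "smoothed_mass k u = (LINT s|count_space S. mass s * kern (2 ^ k * scale) (s - u))"

lemma smoothed_mass_eq_sum:
  "of_real (smoothed_mass k u) = (\<Sum>x\<in>\<Lambda> \<inter> ball 0 (2 ^ k * \<delta>).
     \<mu> {x} * (exp (- 2 * of_real pi * \<i> * of_real (x \<bullet> u)) * kernhat (2 ^ k * scale) x))"
proof -
  have c: "2 ^ k * scale > 0" using scale_pos by simp
  have "complex_of_real (smoothed_mass k u) = (LINT s|count_space S. complex_of_real (mass s * kern (2 ^ k * scale) (s - u)))"
    unfolding smoothed_mass_def by (rule integral_complex_of_real[symmetric])
  also have "\<dots> = (LINT s|count_space S. \<nu> {s} * wave 0 u (2 ^ k * scale) s)"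
    by (simp add: wave_0 of_real_mass)
  finally show ?thesis
    using CARD_scale by (simp add: poisson_wave[OF c] mult.left_commute[of _ "2 ^ k"])
qed

lemma smoothed_mass_nonneg: "0 \<le> smoothed_mass k u"
  unfolding smoothed_mass_def by (intro integral_nonneg_AE AE_I2 mult_nonneg_nonneg mass_nonneg kern_nonneg)

text \<open>The kernels decrease in \<open>k\<close>, so \<open>k = 0\<close> is the worst case.
  There the Poisson sum is finite and \<open>u\<close> enters only through phases of modulus 1, so
  the bound is uniform in \<open>u\<close>.\<close>

lemma smoothed_mass_bounded:
  obtains B where "\<And>k u. smoothed_mass k u \<le> B"
proof
  fix k u
  have c: "2 ^ k * scale > 0" using scale_pos by simp
  have "smoothed_mass k u \<le> smoothed_mass 0 u"
    unfolding smoothed_mass_def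
    by (intro integral_mono integrable_mass_kern)
       (auto intro!: mult_left_mono kern_power_antimono mass_nonneg simp: scale_pos)
  also have "\<dots> \<le> norm (complex_of_real (smoothed_mass 0 u))" by simp
  also have "\<dots> \<le> (\<Sum>x\<in>\<Lambda> \<inter> ball 0 \<delta>. norm (\<mu> {x}) * norm (kernhat scale x))"
    unfolding smoothed_mass_eq_sum power_0 mult_1 by (rule sum_norm_le) (auto simp: norm_mult norm_exp_eq_Re)
  finally show "smoothed_mass k u \<le> (\<Sum>x\<in>\<Lambda> \<inter> ball 0 \<delta>. norm (\<mu> {x}) * norm (kernhat scale x))" .
qed

lemma smoothed_mass_LIMSEQ: "(\<lambda>k. smoothed_mass k u) \<longlonglongrightarrow> mass u"
proof -
  have "integrable (count_space S) (\<lambda>s. kern scale (s - u) *\<^sub>R mass s)"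
    using integrable_mass_kern[OF scale_pos, of u] by (simp add: mult.commute)
  moreover have "mass u = 0" if "u \<notin> S"
    using that mass_pos_iff[of u] mass_nonneg[of u] by simp
  ultimately have "(\<lambda>k. LINT s|count_space S. kern (2 ^ k * scale) (s - u) *\<^sub>R mass s) \<longlonglongrightarrow> mass u"
    by (rule kern_integral_LIMSEQ[OF scale_pos])
  then show ?thesis by (simp add: smoothed_mass_def mult.commute)
qed

text \<open>
  Since \<open>kernhat c\<close> vanishes outside the ball of radius \<open>\<delta>\<close>, only the diagonal of a double sum over
  \<open>\<Lambda> \<times> \<Lambda>\<close> survives; this is why the right-hand side is independent of \<open>x\<close> and involves \<open>c\<close> only
  through the factor \<open>kernhat c 0\<close>.
\<close>

lemma correlation_approx:
  assumes c: "0 < c" "c \<le> scale"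
  shows "of_real (LINT s|count_space S. mass s * smoothed_mass k (s + h) * kern c (s - x)) =
    (\<Sum>l\<in>\<Lambda> \<inter> ball 0 (2 ^ k * \<delta>).
      cnj (\<mu> {l}) * exp (2 * of_real pi * \<i> * of_real (l \<bullet> h)) * cnj (kernhat (2 ^ k * scale) l) * \<mu> {l}) *
    kernhat c 0"
proof -
  define q where "q l = cnj (\<mu> {l}) * exp (2 * of_real pi * \<i> * of_real (l \<bullet> h)) * cnj (kernhat (2 ^ k * scale) l)" for l
  define F where "F = \<Lambda> \<inter> ball 0 (2 ^ k * \<delta>)"
  have smoothed_mass: "complex_of_real (smoothed_mass k (s + h)) =
      (\<Sum>l\<in>F. q l * exp (2 * of_real pi * \<i> * of_real (l \<bullet> s)))" for s
  proof -
    \<comment> \<open>The value is real, so the sum may be conjugated; this gives the frequency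
      \<open>l\<close> the sign that occurs in \<open>wave l\<close>.\<close>
    have "complex_of_real (smoothed_mass k (s + h)) = cnj (of_real (smoothed_mass k (s + h)))" by simp
    also have "\<dots> = (\<Sum>l\<in>F. q l * exp (2 * of_real pi * \<i> * of_real (l \<bullet> s)))"
      unfolding smoothed_mass_eq_sum F_def cnj_sum q_def
      by (intro sum.cong refl) (simp add: exp_cnj inner_add_right distrib_left exp_add mult_ac)
    finally show ?thesis .
  qed
  have "complex_of_real (mass s * smoothed_mass k (s + h) * kern c (s - x)) = (\<Sum>l\<in>F. q l * (\<nu> {s} * wave l x c s))" for s
    by (simp add: smoothed_mass of_real_mass wave_def sum_distrib_left sum_distrib_right mult_ac)
  then have "of_real (LINT s|count_space S. mass s * smoothed_mass k (s + h) * kern c (s - x)) =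
      (LINT s|count_space S. (\<Sum>l\<in>F. q l * (\<nu> {s} * wave l x c s)))"
    by (simp flip: integral_complex_of_real)
  also have "\<dots> = (\<Sum>l\<in>F. q l * (LINT s|count_space S. \<nu> {s} * wave l x c s))"
    using integrable_wave[OF c(1)] by (subst Bochner_Integration.integral_sum) auto
  also have "\<dots> = (\<Sum>l\<in>F. q l * (\<mu> {l} * kernhat c 0))"
  proof (intro sum.cong refl)
    fix l assume "l \<in> F"
    then have l: "l \<in> \<Lambda>" by (simp add: F_def)
    have "real CARD('n) * c \<le> \<delta>"
      using c CARD_scale by (metis mult_left_mono of_nat_0_le_iff)
    moreover have "0 < real CARD('n) * c" using c by simp
    ultimately have "\<Lambda> \<inter> ball l (real CARD('n) * c) = {l}"
      using l by (auto dest: separated[OF l] order.strict_trans2)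
    \<comment> \<open>At the only remaining point \<open>l\<close> the phase is 1, and with it the
      dependence on \<open>x\<close> disappears.\<close>
    then show "q l * (LINT s|count_space S. \<nu> {s} * wave l x c s) = q l * (\<mu> {l} * kernhat c 0)"
      unfolding poisson_wave[OF c(1)] by simp
  qed
  finally show ?thesis
    unfolding F_def q_def by (simp add: sum_distrib_left sum_distrib_right mult_ac)
qed

section \<open>Correlations: limits, invariance and positivity\<close>

definition correlation :: "real ^ 'n \<Rightarrow> real \<Rightarrow> real ^ 'n \<Rightarrow> real" where
  "correlation h c x = (LINT s|count_space S. mass s * mass (s + h) * kern c (s - x))"

lemma integrable_mass_bounded_kern:
  assumes "c > 0" and w: "\<And>s. 0 \<le> w s" "\<And>s. w s \<le> B"
  shows "integrable (count_space S) (\<lambda>s. mass s * w s * kern c (s - x))"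
proof (rule Bochner_Integration.integrable_bound)
  show "integrable (count_space S) (\<lambda>s. B * (mass s * kern c (s - x)))"
    using integrable_mass_kern[OF assms(1)] by simp
  have "mass s * w s * kern c (s - x) \<le> mass s * B * kern c (s - x)" for s
    by (intro mult_right_mono mult_left_mono w mass_nonneg kern_nonneg)
  then show "AE s in count_space S. norm (mass s * w s * kern c (s - x)) \<le> norm (B * (mass s * kern c (s - x)))"
    using order_trans[OF w] by (intro AE_I2) (simp add: abs_mult kern_nonneg mass_nonneg w(1) mult_ac)
qed simp

lemma mass_bounded: obtains B where "\<And>s. mass s \<le> B"
proof -
  obtain B where B: "\<And>k u. smoothed_mass k u \<le> B" by (rule smoothed_mass_bounded) (rule that)
  have "mass s \<le> B" for s
    using B by (intro LIMSEQ_le_const2[OF smoothed_mass_LIMSEQ]) auto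
  then show ?thesis by (rule that)
qed

lemma integrable_correlation:
  assumes "c > 0"
  shows "integrable (count_space S) (\<lambda>s. mass s * mass (s + h) * kern c (s - x))"
proof -
  obtain B where "\<And>s. mass s \<le> B" by (rule mass_bounded) (rule that)
  then show ?thesis
    using mass_nonneg by (intro integrable_mass_bounded_kern[OF assms, of _ B])
qed

text \<open>Dominated convergence; the bound on \<open>smoothed_mass\<close>, uniform in
  \<open>k\<close> and in the point, supplies the majorant.\<close>

lemma correlation_LIMSEQ:
  assumes c: "c > 0"
  shows "(\<lambda>k. LINT s|count_space S. mass s * smoothed_mass k (s + h) * kern c (s - x)) \<longlonglongrightarrow> correlation h c x"
proof -
  obtain B where B: "\<And>k u. smoothed_mass k u \<le> B" by (rule smoothed_mass_bounded) (rule that)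
  show ?thesis
    unfolding correlation_def
  proof (rule integral_dominated_convergence)
    show "integrable (count_space S) (\<lambda>s. B * (mass s * kern c (s - x)))"
      using integrable_mass_kern[OF c] by simp
    show "AE s in count_space S. (\<lambda>k. mass s * smoothed_mass k (s + h) * kern c (s - x)) \<longlonglongrightarrow> mass s * mass (s + h) * kern c (s - x)"
      by (intro AE_I2 tendsto_mult tendsto_const smoothed_mass_LIMSEQ)
    fix k
    have "mass s * smoothed_mass k (s + h) * kern c (s - x) \<le> mass s * B * kern c (s - x)" for s
      by (intro mult_right_mono mult_left_mono B mass_nonneg kern_nonneg)
    then show "AE s in count_space S. norm (mass s * smoothed_mass k (s + h) * kern c (s - x)) \<le> B * (mass s * kern c (s - x))"
      by (intro AE_I2) (simp add: abs_mult smoothed_mass_nonneg mass_nonneg kern_nonneg mult_ac)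
  qed auto
qed

text \<open>Already at each finite \<open>k\<close> the two sides differ only through
  \<open>kernhat c 0\<close>, by \<open>correlation_approx\<close>. The centres \<open>x\<close> and
  \<open>y\<close> are unrelated, so independence of the centre and the scaling law are recorded
  together.\<close>

lemma correlation_half: "correlation h (scale / 2) x = 2 ^ CARD('n) * correlation h scale y"
proof -
  have "(LINT s|count_space S. mass s * smoothed_mass k (s + h) * kern (scale / 2) (s - x)) =
      2 ^ CARD('n) * (LINT s|count_space S. mass s * smoothed_mass k (s + h) * kern scale (s - y))" for k
  proof -
    have "complex_of_real (LINT s|count_space S. mass s * smoothed_mass k (s + h) * kern (scale / 2) (s - x)) =
        of_real (2 ^ CARD('n) * (LINT s|count_space S. mass s * smoothed_mass k (s + h) * kern scale (s - y)))"
      using scale_pos unfolding of_real_mult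
      by (subst (1 2) correlation_approx) (simp_all add: kernhat_half)
    then show ?thesis by (simp only: of_real_eq_iff)
  qed
  then have "(\<lambda>k. LINT s|count_space S. mass s * smoothed_mass k (s + h) * kern (scale / 2) (s - x)) \<longlonglongrightarrow> 2 ^ CARD('n) * correlation h scale y"
    using tendsto_mult_left[OF correlation_LIMSEQ[OF scale_pos]] by simp
  moreover have "(\<lambda>k. LINT s|count_space S. mass s * smoothed_mass k (s + h) * kern (scale / 2) (s - x)) \<longlonglongrightarrow> correlation h (scale / 2) x"
    using scale_pos by (intro correlation_LIMSEQ) simp
  ultimately show ?thesis by (rule LIMSEQ_unique[rotated])
qed

lemma correlation_pos:
  assumes "s \<in> S" "s + h \<in> S"
  shows "correlation h scale x > 0"
proof -
  \<comment> \<open>Both values are compared with the same correlation at scale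
    \<open>scale / 2\<close> and centre 0. Centring at \<open>s\<close> is useful because the kernel
    equals 1 there.\<close>
  have "correlation h scale x = correlation h scale s"
    using correlation_half[of h 0 x] correlation_half[of h 0 s] by simp
  moreover have "correlation h scale s \<noteq> 0"
  proof
    assume "correlation h scale s = 0"
    then have "AE t in count_space S. mass t * mass (t + h) * kern scale (t - s) = 0"
      unfolding correlation_def using integrable_correlation[OF scale_pos]
      by (subst (asm) integral_nonneg_eq_0_iff_AE) (auto simp: mass_nonneg kern_nonneg)
    then have "mass s * mass (s + h) * kern scale (s - s) = 0"
      using assms by (auto simp: AE_count_space)
    moreover have "mass s > 0" "mass (s + h) > 0"
      using assms mass_pos_iff by auto
    ultimately show False by simp
  qed
  moreover have "0 \<le> correlation h scale s"
    unfolding correlation_def by (intro integral_nonneg_AE AE_I2 mult_nonneg_nonneg mass_nonneg kern_nonneg)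
  ultimately show ?thesis by simp
qed

section \<open>Recurrence of differences and accumulation points\<close>

lemma pairs_relatively_dense:
  obtains R where "R > 0"
    "\<And>h x s. s \<in> S \<Longrightarrow> s + h \<in> S \<Longrightarrow> \<exists>t\<in>S. t + h \<in> S \<and> dist t x < R"
proof
  define n where "n = CARD('n)"
  \<comment> \<open>If \<open>norm y \<ge> R\<close>, some coordinate is at least
    \<open>R / n\<close>, and \<open>scale / 2 * (R / n) = 2 ^ n\<close>. The resulting gain of
    2^(-2n) outweighs the factor 2^n of \<open>correlation_half\<close> and leaves 2^(-n), which is
    less than 1.\<close>
  define R where "R = 2 * real n * 2 ^ n / scale"
  have n: "n > 0" by (simp add: n_def)
  show R: "R > 0" using scale_pos n by (simp add: R_def)
  fix h x s assume s: "s \<in> S" "s + h \<in> S"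
  show "\<exists>t\<in>S. t + h \<in> S \<and> dist t x < R"
  proof (rule ccontr)
    assume far: "\<not> ?thesis"
    have decay: "kern scale y \<le> (1 / 2 ^ n)\<^sup>2 * kern (scale / 2) y" if "norm y \<ge> R" for y :: "real ^ 'n"
    proof -
      have "\<exists>i. R / n \<le> \<bar>y $ i\<bar>"
      proof (rule ccontr)
        assume "\<not> ?thesis"
        then have "(\<Sum>i\<in>UNIV. \<bar>y $ i\<bar>) < (\<Sum>i\<in>(UNIV::'n set). R / n)"
          by (intro sum_strict_mono) (auto simp: not_le)
        with norm_le_l1_cart[of y] that n show False by (simp add: n_def)
      qed
      then obtain i where i: "R / n \<le> \<bar>y $ i\<bar>" ..
      then have yi: "y $ i \<noteq> 0" using R n by (auto simp: field_simps)
      have "kern (2 * (scale / 2)) y \<le> 1 / (scale / 2 * y $ i)\<^sup>2 * kern (scale / 2) y"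
        using scale_pos yi by (intro kern_double_le_decay) auto
      also have "\<dots> \<le> 1 / (2 ^ n)\<^sup>2 * kern (scale / 2) y"
      proof (intro mult_right_mono kern_nonneg divide_left_mono)
        have "2 ^ n = scale / 2 * (R / n)"
          using scale_pos n by (simp add: R_def)
        also have "\<dots> \<le> scale / 2 * \<bar>y $ i\<bar>"
          using i scale_pos by (intro mult_left_mono) auto
        finally have "2 ^ n \<le> \<bar>scale / 2 * y $ i\<bar>"
          using scale_pos by (simp add: abs_mult)
        then have "(2 ^ n)\<^sup>2 \<le> \<bar>scale / 2 * y $ i\<bar>\<^sup>2"
          by (rule power_mono) simp
        then show "(2 ^ n)\<^sup>2 \<le> (scale / 2 * y $ i)\<^sup>2" by (simp only: power2_abs)
      qed (use scale_pos yi in auto)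
      finally show ?thesis by (simp add: power_divide)
    qed
    have "correlation h scale x \<le> (LINT t|count_space S. (1 / 2 ^ n)\<^sup>2 * (mass t * mass (t + h) * kern (scale / 2) (t - x)))"
      unfolding correlation_def
    proof (rule integral_mono)
      show "integrable (count_space S) (\<lambda>t. (1 / 2 ^ n)\<^sup>2 * (mass t * mass (t + h) * kern (scale / 2) (t - x)))"
        using scale_pos integrable_correlation[of "scale / 2"] by simp
      fix t assume "t \<in> space (count_space S)"
      then have t: "t \<in> S" by simp
      show "mass t * mass (t + h) * kern scale (t - x) \<le> (1 / 2 ^ n)\<^sup>2 * (mass t * mass (t + h) * kern (scale / 2) (t - x))"
      \<comment> \<open>Only points \<open>t\<close> with \<open>t + h\<close> in \<open>S\<close>
        contribute, and by assumption these are all at distance at least \<open>R\<close> from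
        \<open>x\<close>.\<close>
      proof (cases "t + h \<in> S")
        case True
        with far t have "norm (t - x) \<ge> R" by (force simp: dist_norm)
        from mult_left_mono[OF decay[OF this], of "mass t * mass (t + h)"] show ?thesis
          by (simp add: mass_nonneg mult_ac)
      next
        case False
        then have "mass (t + h) = 0"
          using mass_pos_iff[of "t + h"] mass_nonneg[of "t + h"] by simp
        then show ?thesis by simp
      qed
    qed (rule integrable_correlation[OF scale_pos])
    also have "\<dots> = (1 / 2 ^ n)\<^sup>2 * correlation h (scale / 2) x"
      by (simp add: correlation_def)
    also have "\<dots> = (1 / 2 ^ n) * correlation h scale x"
      by (simp add: correlation_half[of h x x] n_def power2_eq_square)
    finally have "correlation h scale x \<le> (1 / 2 ^ n) * correlation h scale x" .
    moreover have "(1 / 2 ^ n) * correlation h scale x < 1 * correlation h scale x"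
      using correlation_pos[OF s] n by (intro mult_strict_right_mono) auto
    ultimately show False by simp
  qed
qed

lemma relatively_dense_limpts:
  assumes "\<not> uniform_discrete S"
  shows "relatively_dense {x. x islimpt S}"
proof -
  obtain R where R: "R > 0"
    "\<And>h x s. s \<in> S \<Longrightarrow> s + h \<in> S \<Longrightarrow> \<exists>t\<in>S. t + h \<in> S \<and> dist t x < R"
    using pairs_relatively_dense by metis
  have "ball x (R + 2) \<inter> {y. y islimpt S} \<noteq> {}" for x
  proof -
    \<comment> \<open>A finite intersection would have a positive minimal distance \<open>e\<close>,
      contradicted by a recurring pair closer than \<open>e\<close>.\<close>
    have "infinite (S \<inter> cball x (R + 1))"
    proof
      assume "finite (S \<inter> cball x (R + 1))"
      then have "uniform_discrete (S \<inter> cball x (R + 1))"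
        using uniform_discrete_finite_iff by blast
      then obtain e where e: "e > 0"
        "\<And>y z. y \<in> S \<inter> cball x (R + 1) \<Longrightarrow> z \<in> S \<inter> cball x (R + 1) \<Longrightarrow> dist y z < e \<Longrightarrow> y = z"
        unfolding uniform_discrete_def by blast
      \<comment> \<open>The bound 1 keeps the second point of the recurring pair inside the ball of
        radius \<open>R + 1\<close>.\<close>
      obtain s s' where s: "s \<in> S" "s' \<in> S" "dist s s' < min e 1" "s \<noteq> s'"
        using assms e(1) unfolding uniform_discrete_def by (metis min_less_iff_conj zero_less_one)
      define h where "h = s' - s"
      have h: "norm h < e" "norm h < 1" "h \<noteq> 0" "s + h \<in> S"
        using s by (auto simp: h_def dist_norm norm_minus_commute)
      obtain t where t: "t \<in> S" "t + h \<in> S" "dist t x < R"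
        using R(2)[OF s(1) h(4)] by blast
      have "dist (t + h) x \<le> dist t x + norm h"
        by (metis add.commute add_diff_cancel_right' dist_norm dist_triangle add_diff_cancel_left')
      then have "t = t + h"
        using t h by (intro e(2)) (auto simp: dist_commute dist_norm)
      with h(3) show False by simp
    qed
    \<comment> \<open>Bolzano-Weierstrass in the closed ball; the radius \<open>R + 2\<close>
      afterwards passes to an open ball.\<close>
    then obtain y where "y \<in> cball x (R + 1)" "y islimpt (S \<inter> cball x (R + 1))"
      using compact_cball[of x "R + 1"] unfolding compact_eq_Bolzano_Weierstrass by (metis inf_le2)
    then have "y \<in> ball x (R + 2) \<inter> {y. y islimpt S}"
      using islimpt_subset[of y "S \<inter> cball x (R + 1)" S] by auto
    then show ?thesis by blast
  qed
  then show ?thesis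
    unfolding relatively_dense_def using R(1) by (intro exI[of _ "R + 2"]) auto
qed

end

theorem theorem5p1:
  fixes \<mu> \<mu>hat :: "(real ^ 'n::finite) set \<Rightarrow> complex"
    and \<Lambda> S :: "(real ^ 'n) set"
  assumes "slowly_increasing \<mu>"
    and "positive_definite \<mu>"
    and "uniform_discrete \<Lambda>"
    and "sum_of_atoms \<mu> \<Lambda>"
    and "\<forall>l\<in>\<Lambda>. \<mu> {l} \<noteq> 0"
    and "slowly_increasing \<mu>hat"
    and "fourier_transform_is \<mu> \<mu>hat"
    and "countable S"
    and "sum_of_atoms \<mu>hat S"
    and "\<forall>s\<in>S. \<mu>hat {s} \<noteq> 0"
  shows "uniform_discrete S \<or> relatively_dense {x. x islimpt S}"
proof -
  obtain \<delta> where "\<delta> > 0" "\<And>x y. x \<in> \<Lambda> \<Longrightarrow> y \<in> \<Lambda> \<Longrightarrow> dist x y < \<delta> \<Longrightarrow> x = y"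
    using assms(3) unfolding uniform_discrete_def by blast
  then interpret fourier_pair \<mu> \<mu>hat \<Lambda> S \<delta>
    using assms by unfold_locales auto
  show ?thesis
    using relatively_dense_limpts by blast
qed

end
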